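(* Let $E,A\in\mathbb R^{n\times n}$, $B\in\mathbb R^{n\times m}$, $C\in\mathbb R^{m\times n}$ be such that the descriptor system $E\dot x=Ax+Bu$, $y=Cx$ is port-Hamiltonian. Then there exists a matrix $F\in\mathbb R^{m\times m}$ such that the pencil $(E,A+BFC)$ is regular, $\operatorname{ind}(E,A+BFC)\le 1$, and the closed-loop system $$E\dot x=(A+BFC)x+Bv,\qquad y=Cx$$ is port-Hamiltonian, if and only if $$\operatorname{rank}\begin{bmatrix} E & A\,\mathcal S_\infty(E)\\ 0 & C\,\mathcal S_\infty(E)\end{bmatrix}=n .$$
   Context: Port-Hamiltonian: a system $E\dot x=Ax+Bu$, $y=Cx$ with $E,A\in\mathbb R^{n\times n}$, $B\in\mathbb R^{n\times m}$, $C\in\mathbb R^{m\times n}$ is called port-Hamiltonian if there exist $J,R,Q\in\mathbb R^{n\times n}$ and $G,P\in\mathbb R^{n\times m}$ with $J=-J^T$ such that $$A=(J-R)Q,\quad B=G-P,\quad C=(G+P)^TQ,$$ $$Q^TE=E^TQ\ge 0,\quad Q^TRQ=Q^TR^TQ\ge 0,\quad Q^TP=0,$$ where $M\ge 0$ means that $M$ is symmetric positive semidefinite. $E$ and $Q$ may be singular. The closed-loop system is port-Hamiltonian if the same definition holds with the closed-loop coefficient matrices in place of $E,A,B,C$. Regularity and index: the pencil $(E,A)$ is regular if $\det(\alpha E-\beta A)\ne 0$ for some $(\alpha,\beta)\in\mathbb C^2$. For a regular pencil there are nonsingular $X,Y$ with $X(sE-A)Y=\operatorname{diag}(sI-\hat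 J,\ sN-I)$ with $N$ nilpotent; the index $\operatorname{ind}(E,A)$ is the degree of nilpotency of $N$ (the smallest $i$ with $N^i=0$; it is $0$ if the block $N$ is absent). A pencil is regular with index at most one if and only if it has exactly $\operatorname{rank}(E)$ finite eigenvalues (counted with multiplicity). Notation: $\mathcal S_\infty(M)$ denotes a full column rank matrix whose columns span the right nullspace of $M$ (an empty matrix if the nullspace is trivial). *)

theory Defs
  imports
    Complex_Main
    "Jordan_Normal_Form.DL_Rank"
    "Jordan_Normal_Form.Matrix_Kernel"
begin

definition sym_pos_semidef :: "nat \<Rightarrow> real mat \<Rightarrow> bool" where
  "sym_pos_semidef n M \<longleftrightarrow>
     M \<in> carrier_mat n n \<and> transpose_mat M = M \<and>
     (\<forall>v \<in> carrier_vec n. 0 \<le> v \<bullet> (M *\<^sub>v v))"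

definition port_hamiltonian ::
    "nat \<Rightarrow> nat \<Rightarrow> real mat \<Rightarrow> real mat \<Rightarrow> real mat \<Rightarrow> real mat \<Rightarrow> bool" where
  "port_hamiltonian n m E A B C \<longleftrightarrow>
     E \<in> carrier_mat n n \<and> A \<in> carrier_mat n n \<and>
     B \<in> carrier_mat n m \<and> C \<in> carrier_mat m n \<and>
     (\<exists>J \<in> carrier_mat n n. \<exists>R \<in> carrier_mat n n. \<exists>Q \<in> carrier_mat n n.
      \<exists>G \<in> carrier_mat n m. \<exists>P \<in> carrier_mat n m.
        J = - transpose_mat J \<and>
        A = (J - R) * Q \<and>
        B = G - P \<and>
        C = transpose_mat (G + P) * Q \<and>
        transpose_mat Q * E = transpose_mat E * Q \<and>
        sym_pos_semidef n (transpose_mat Q * E) \<and>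
        transpose_mat Q * R * Q = transpose_mat Q * transpose_mat R * Q \<and>
        sym_pos_semidef n (transpose_mat Q * R * Q) \<and>
        transpose_mat Q * P = 0\<^sub>m n m)"

abbreviation cmat :: "real mat \<Rightarrow> complex mat" where
  "cmat \<equiv> map_mat complex_of_real"

definition regular_pencil :: "real mat \<Rightarrow> real mat \<Rightarrow> bool" where
  "regular_pencil E A \<longleftrightarrow>
     (\<exists>\<alpha> \<beta> :: complex. det (\<alpha> \<cdot>\<^sub>m cmat E - \<beta> \<cdot>\<^sub>m cmat A) \<noteq> 0)"

definition nilpotent_mat :: "complex mat \<Rightarrow> bool" where
  "nilpotent_mat N \<longleftrightarrow> (\<exists>i. N ^\<^sub>m i = 0\<^sub>m (dim_row N) (dim_col N))"

text \<open>For the \<open>0 \<times> 0\<close> matrix the degree is \<open>0\<close>.\<close>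

definition nilpotency_degree :: "complex mat \<Rightarrow> nat" where
  "nilpotency_degree N = (LEAST i. N ^\<^sub>m i = 0\<^sub>m (dim_row N) (dim_col N))"

text \<open>
  \<open>X (s E - A) Y = diag (s I - J, s N - I)\<close> as an identity of matrix pencils.
  Either diagonal block may be absent (\<open>p = 0\<close> or \<open>q = 0\<close>).
\<close>

definition weierstrass_form ::
    "real mat \<Rightarrow> real mat \<Rightarrow> complex mat \<Rightarrow> complex mat \<Rightarrow> complex mat \<Rightarrow> complex mat \<Rightarrow> bool" where
  "weierstrass_form E A X Y J N \<longleftrightarrow>
     (\<exists>n p q. n = p + q \<and>
        E \<in> carrier_mat n n \<and> A \<in> carrier_mat n n \<and>
        X \<in> carrier_mat n n \<and> invertible_mat X \<and>
        Y \<in> carrier_mat n n \<and> invertible_mat Y \<and>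
        J \<in> carrier_mat p p \<and> N \<in> carrier_mat q q \<and> nilpotent_mat N \<and>
        (\<forall>s. X * (s \<cdot>\<^sub>m cmat E - cmat A) * Y =
             four_block_mat (s \<cdot>\<^sub>m 1\<^sub>m p - J) (0\<^sub>m p q) (0\<^sub>m q p) (s \<cdot>\<^sub>m N - 1\<^sub>m q)))"

text \<open>
  A regular pencil has a Weierstrass form, and the nilpotency degree of \<open>N\<close> is the
  same for all of them, so the choice is immaterial. The value is meaningful only for
  regular pencils.
\<close>

definition pencil_index :: "real mat \<Rightarrow> real mat \<Rightarrow> nat" where
  "pencil_index E A = nilpotency_degree (SOME N. \<exists>X Y J. weierstrass_form E A X Y J N)"

text \<open>
  \<open>S\<close> has full column rank and its columns span the right nullspace of \<open>M\<close>;
  \<open>S\<close> has no columns if the nullspace is trivial.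
\<close>

definition nullspace_matrix :: "real mat \<Rightarrow> real mat \<Rightarrow> bool" where
  "nullspace_matrix M S \<longleftrightarrow>
     dim_row S = dim_col M \<and>
     vec_space.rank (dim_row S) S = dim_col S \<and>
     vec_space.col_space (dim_row S) S = mat_kernel M"

end

theory Submission
  imports Defs "Jordan_Normal_Form.Schur_Decomposition"
begin

text \<open>
  Call a pencil \<open>(E, A)\<close> impulse-free if \<open>E x = 0\<close> and \<open>A x = E z\<close> imply \<open>x = 0\<close>. Both sides of the
  equivalence are statements of this type.

  A pencil is regular with index at most one exactly when it is impulse-free
  (\<open>regular_and_index_le_1_iff_impulse_free\<close>). Impulse-freeness is invariant under multiplication
  by invertible matrices, and for a pencil in Weierstrass form it says that the nilpotent block
  vanishes. Two existence statements complete this argument. A regular pencil has a Weierstrass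
  form, by the Fitting decomposition of \<open>(\<alpha> E - \<beta> A)\<^sup>-\<^sup>1 E\<close> (\<open>weierstrass_form_exists\<close>); and an
  impulse-free pencil is regular, because a polynomial kernel vector of \<open>s E - A\<close> would have a
  forbidden leading coefficient (\<open>impulse_free_pencil_det_nonzero\<close>).

  By rank-nullity, the rank condition says that \<open>E x = 0\<close>, \<open>C x = 0\<close> and \<open>A x = E z\<close> imply \<open>x = 0\<close>
  (\<open>rank_nullspace_block_iff\<close>), that is, impulse-freeness restricted to \<open>ker C\<close>.

  The rank condition is necessary for any feedback, since \<open>A\<close> and \<open>A + B F C\<close> agree on \<open>ker C\<close>.
  Conversely \<open>F = - I\<close> works. The condition \<open>Q\<^sup>T P = 0\<close> gives \<open>C = B\<^sup>T Q\<close>, so this feedback merely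
  adds the damping term \<open>C\<^sup>T C\<close> to \<open>Q\<^sup>T R Q\<close> and the closed loop is again port-Hamiltonian. If
  \<open>E x = 0\<close> and \<open>(A - B C) x = E z\<close>, then multiplication by \<open>(Q x)\<^sup>T\<close> yields
  \<open>0 = - x\<^sup>T Q\<^sup>T R Q x - \<parallel>C x\<parallel>\<^sup>2\<close>; hence \<open>C x = 0\<close> and \<open>A x = E z\<close>, and the rank condition gives \<open>x = 0\<close>.
\<close>

section \<open>Inverses, powers and quadratic forms\<close>

lemma zero_mat_mult_vec:
  "v \<in> carrier_vec nc \<Longrightarrow> 0\<^sub>m nr nc *\<^sub>v (v :: 'a::semiring_0 vec) = 0\<^sub>v nr"
  by (intro eq_vecI) auto

lemma mult_mat_zero_vec:
  "A \<in> carrier_mat nr nc \<Longrightarrow> A *\<^sub>v 0\<^sub>v nc = (0\<^sub>v nr :: 'a::semiring_0 vec)"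
  by (intro eq_vecI) auto

lemma mat_eq_zero_iff:
  fixes A :: "'a::field mat"
  assumes A: "A \<in> carrier_mat nr nc"
  shows "A = 0\<^sub>m nr nc \<longleftrightarrow> (\<forall>v\<in>carrier_vec nc. A *\<^sub>v v = 0\<^sub>v nr)"
proof
  assume H: "\<forall>v\<in>carrier_vec nc. A *\<^sub>v v = 0\<^sub>v nr"
  show "A = 0\<^sub>m nr nc"
  proof (rule eq_matI)
    fix i j assume "i < dim_row (0\<^sub>m nr nc :: 'a mat)" "j < dim_col (0\<^sub>m nr nc :: 'a mat)"
    hence ij: "i < nr" "j < nc" by auto
    have "A $$ (i, j) = (A *\<^sub>v unit_vec nc j) $ i" using A ij by (simp add: row_def)
    thus "A $$ (i, j) = 0\<^sub>m nr nc $$ (i, j)" using H ij by simp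
  qed (use A in auto)
qed (use A in auto)

lemma invertible_mat_inverse:
  assumes "X \<in> carrier_mat n n" "invertible_mat X"
  obtains X' where "X' \<in> carrier_mat n n" "X * X' = 1\<^sub>m n" "X' * X = 1\<^sub>m n"
proof -
  obtain X' where X': "inverts_mat X X'" "inverts_mat X' X"
    using assms(2) by (auto simp: invertible_mat_def)
  have 1: "X * X' = 1\<^sub>m n" using X'(1) assms(1) by (simp add: inverts_mat_def)
  have 2: "X' * X = 1\<^sub>m (dim_row X')" using X'(2) by (simp add: inverts_mat_def)
  have "dim_col X' = n" using arg_cong[OF 1, of dim_col] by simp
  moreover have "dim_row X' = n" using arg_cong[OF 2, of dim_col] assms(1) by simp
  ultimately have "X' \<in> carrier_mat n n" "X' * X = 1\<^sub>m n" using 2 by auto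
  with 1 show ?thesis using that by blast
qed

lemma invertible_matI_inverse:
  assumes "X \<in> carrier_mat n n" "X' \<in> carrier_mat n n" "X * X' = 1\<^sub>m n" "X' * X = 1\<^sub>m n"
  shows "invertible_mat X"
proof -
  have "inverts_mat X X'" "inverts_mat X' X" using assms by (simp_all add: inverts_mat_def)
  thus ?thesis using assms(1) unfolding invertible_mat_def by (intro conjI exI[of _ X']) simp_all
qed

lemma det_nonzero_inverse:
  fixes A :: "'a::field mat"
  assumes A: "A \<in> carrier_mat n n" and d: "det A \<noteq> 0"
  obtains B where "B \<in> carrier_mat n n" "A * B = 1\<^sub>m n" "B * A = 1\<^sub>m n"
  using det_non_zero_imp_unit[OF A d, of "()"] that by (auto simp: Units_def ring_mat_def)

lemma mult_inverse_of_product: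
  assumes "X \<in> carrier_mat n n" "X' \<in> carrier_mat n n" "X * X' = 1\<^sub>m n" "X' * X = 1\<^sub>m n"
    "Y \<in> carrier_mat n n" "Y' \<in> carrier_mat n n" "Y * Y' = 1\<^sub>m n" "Y' * Y = 1\<^sub>m n"
  shows "(X * Y) * (Y' * X') = (1\<^sub>m n :: 'a::comm_ring_1 mat)"
proof -
  have "(X * Y) * (Y' * X') = X * (Y * (Y' * X'))"
    using assms by (intro assoc_mult_mat) auto
  also have "Y * (Y' * X') = (Y * Y') * X'"
    using assms by (intro assoc_mult_mat[symmetric]) auto
  finally show ?thesis using assms(2,3,7) by simp
qed

lemma pow_mat_Suc_left:
  fixes A :: "'a::semiring_1 mat"
  assumes A: "A \<in> carrier_mat n n"
  shows "A ^\<^sub>m Suc k = A * A ^\<^sub>m k"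
proof (induct k)
  case (Suc k)
  have "A ^\<^sub>m Suc (Suc k) = A * A ^\<^sub>m k * A" using Suc by simp
  also have "\<dots> = A * (A ^\<^sub>m k * A)" using A by (intro assoc_mult_mat) auto
  finally show ?case by simp
qed (use A in simp)

lemma commuting_product_pow:
  fixes W K :: "'a::comm_semiring_1 mat"
  assumes W: "W \<in> carrier_mat q q" and K: "K \<in> carrier_mat q q" and WK: "W * K = K * W"
  shows "(W * K) ^\<^sub>m k = W ^\<^sub>m k * K ^\<^sub>m k"
proof (induct k)
  case (Suc k)
  have c: "W ^\<^sub>m k \<in> carrier_mat q q" "K ^\<^sub>m k \<in> carrier_mat q q" using W K by auto
  note as = assoc_mult_mat[of _ q q _ q _ q]
  have comm: "K ^\<^sub>m k * W = W * K ^\<^sub>m k"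
  proof (induct k)
    case (Suc k)
    have ck: "K ^\<^sub>m k \<in> carrier_mat q q" using K by simp
    have "K ^\<^sub>m Suc k * W = K ^\<^sub>m k * (K * W)" using ck K W by (simp add: as)
    also have "\<dots> = K ^\<^sub>m k * W * K" using ck K W by (simp add: WK[symmetric] as)
    also have "\<dots> = W * K ^\<^sub>m Suc k" using ck K W by (simp add: Suc as)
    finally show ?case .
  qed (use W K in simp)
  have "(W * K) ^\<^sub>m Suc k = W ^\<^sub>m k * ((K ^\<^sub>m k * W) * K)" using c W K
    by (simp add: Suc as del: pow_carrier_mat)
  also have "\<dots> = W ^\<^sub>m Suc k * K ^\<^sub>m Suc k" unfolding comm using c W K
    by (simp add: as del: pow_carrier_mat)
  finally show ?case .
qed (use W K in simp)

lemma sandwich_pencil: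
  fixes E A X Y :: "'a::comm_ring_1 mat"
  assumes E: "E \<in> carrier_mat n n" and A: "A \<in> carrier_mat n n"
    and X: "X \<in> carrier_mat n n" and Y: "Y \<in> carrier_mat n n"
  shows "X * (s \<cdot>\<^sub>m E - A) * Y = s \<cdot>\<^sub>m (X * E * Y) - X * A * Y"
proof -
  have "X * (s \<cdot>\<^sub>m E - A) = s \<cdot>\<^sub>m (X * E) - X * A"
    using mult_minus_distrib_mat[OF X _ A, of "s \<cdot>\<^sub>m E"] mult_smult_distrib[OF X E] E by simp
  moreover have "(s \<cdot>\<^sub>m (X * E) - X * A) * Y = s \<cdot>\<^sub>m (X * E) * Y - X * A * Y"
    using X E A Y by (intro minus_mult_distrib_mat) auto
  moreover have "s \<cdot>\<^sub>m (X * E) * Y = s \<cdot>\<^sub>m (X * E * Y)"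
    using X E Y by (intro mult_smult_assoc_mat) auto
  ultimately show ?thesis by simp
qed

lemma scalar_prod_self_nonneg: "0 \<le> v \<bullet> (v :: real vec)"
  by (auto simp: scalar_prod_def intro: sum_nonneg)

lemma scalar_prod_self_eq_0:
  assumes "v \<in> carrier_vec n" "v \<bullet> (v :: real vec) = 0"
  shows "v = 0\<^sub>v n"
  using assms by (auto simp: scalar_prod_def sum_nonneg_eq_0_iff vec_eq_iff)

lemma scalar_prod_mult_mat_vec:
  fixes M :: "'a::comm_semiring_0 mat"
  assumes M: "M \<in> carrier_mat nr nc" and x: "x \<in> carrier_vec nc" and y: "y \<in> carrier_vec nr"
  shows "(M *\<^sub>v x) \<bullet> y = x \<bullet> (transpose_mat M *\<^sub>v y)"
  using transpose_vec_mult_scalar[OF M x y] comm_scalar_prod[of "M *\<^sub>v x" nr y]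
    comm_scalar_prod[of x nc "transpose_mat M *\<^sub>v y"] M x y by simp

lemma skew_quadratic_form_zero:
  fixes J :: "real mat"
  assumes J: "J \<in> carrier_mat n n" "J = - transpose_mat J" and v: "v \<in> carrier_vec n"
  shows "v \<bullet> (J *\<^sub>v v) = 0"
proof -
  have "(J *\<^sub>v v) \<bullet> v = v \<bullet> (transpose_mat J *\<^sub>v v)" by (rule scalar_prod_mult_mat_vec[OF J(1) v v])
  moreover have "(J *\<^sub>v v) \<bullet> v = v \<bullet> (J *\<^sub>v v)" using J(1) v by (intro comm_scalar_prod) auto
  moreover have "v \<bullet> (J *\<^sub>v v) = v \<bullet> ((- transpose_mat J) *\<^sub>v v)" using J(2) by simp
  moreover have "v \<bullet> ((- transpose_mat J) *\<^sub>v v) = - (v \<bullet> (transpose_mat J *\<^sub>v v))"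
    using J(1) v by simp
  ultimately show ?thesis by simp
qed

section \<open>Rank and kernel\<close>

lemma linear_map_mult_mat_vec:
  fixes A :: "'a::field mat"
  assumes A: "A \<in> carrier_mat nr nc"
  shows "linear_map class_ring (module_vec TYPE('a) nc) (module_vec TYPE('a) nr) (\<lambda>v. A *\<^sub>v v)"
proof (intro linear_map.intro mod_hom.intro mod_hom_axioms.intro)
  show "(\<lambda>v. A *\<^sub>v v) \<in> LinearCombinations.module_hom class_ring (module_vec TYPE('a) nc) (module_vec TYPE('a) nr)"
    using A
    by (simp add: LinearCombinations.module_hom_def module_vec_simps class_ring_simps
        mult_add_distrib_mat_vec[OF A] mult_mat_vec[OF A])
qed (auto intro: vec_vs vec_module)

lemma kernel_eq_mat_kernel:
  fixes A :: "'a::field mat"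
  assumes A: "A \<in> carrier_mat nr nc"
  shows "mod_hom.ker (module_vec TYPE('a) nc) (module_vec TYPE('a) nr) (\<lambda>v. A *\<^sub>v v) = mat_kernel A"
proof -
  interpret L: linear_map class_ring "module_vec TYPE('a) nc" "module_vec TYPE('a) nr" "\<lambda>v. A *\<^sub>v v"
    by (rule linear_map_mult_mat_vec[OF A])
  show ?thesis
    using A by (auto simp: L.ker_def mat_kernel_def module_vec_simps)
qed

lemma rank_plus_kernel_dim:
  fixes A :: "'a::field mat"
  assumes A: "A \<in> carrier_mat nr nc"
  shows "vec_space.rank nr A + kernel_dim A = nc"
proof -
  interpret C: vec_space "TYPE('a)" nc .
  interpret R: vec_space "TYPE('a)" nr .
  interpret L: linear_map class_ring "module_vec TYPE('a) nc" "module_vec TYPE('a) nr" "\<lambda>v. A *\<^sub>v v"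
    by (rule linear_map_mult_mat_vec[OF A])
  have im: "L.imT = R.span (set (cols A))"
    using A R.col_space_eq[OF A]
    by (auto simp: L.im_def R.col_space_def[symmetric] module_vec_simps image_iff)
  show ?thesis
    using L.rank_nullity[OF C.fin_dim] A
    by (simp add: kernel_eq_mat_kernel[OF A] im R.rank_def kernel_dim_def C.dim_is_n)
qed

lemma subspace_mat_kernel:
  fixes A :: "'a::field mat"
  assumes A: "A \<in> carrier_mat nr nc"
  shows "VectorSpace.subspace class_ring (mat_kernel A) (module_vec TYPE('a) nc)"
proof -
  interpret L: linear_map class_ring "module_vec TYPE('a) nc" "module_vec TYPE('a) nr" "\<lambda>v. A *\<^sub>v v"
    by (rule linear_map_mult_mat_vec[OF A])
  show ?thesis using L.kerT_is_subspace by (simp add: kernel_eq_mat_kernel[OF A])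
qed

lemma kernel_fin_dim:
  fixes A :: "'a::field mat"
  assumes A: "A \<in> carrier_mat nr nc"
  shows "vectorspace.fin_dim class_ring (module_vec TYPE('a) nc\<lparr>carrier := mat_kernel A\<rparr>)"
proof -
  interpret K: kernel nr nc A by unfold_locales (rule A)
  show ?thesis using kernel_basis_exists[OF A]
    by (auto simp: K.Ker.fin_dim_def K.Ker.basis_def)
qed

lemma (in vectorspace) subspace_eq_of_dim_eq:
  assumes U: "VectorSpace.subspace K U V" and W: "VectorSpace.subspace K W V" and UW: "U \<subseteq> W"
    and fU: "vectorspace.fin_dim K (vs U)" and fW: "vectorspace.fin_dim K (vs W)"
    and d: "vectorspace.dim K (vs U) = vectorspace.dim K (vs W)"
  shows "U = W"
proof -
  interpret U: vectorspace K "vs U" by (rule subspace_is_vs[OF U])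
  interpret W: vectorspace K "vs W" by (rule subspace_is_vs[OF W])
  have sU: "submodule K U V" and sW: "submodule K W V"
    using U W by (auto simp: subspace_def)
  obtain b where b: "finite b" "U.basis b" using U.finite_basis_exists[OF fU] by blast
  hence bU: "b \<subseteq> U" and li: "U.lin_indpt b" and gen: "U.span b = U"
    by (auto simp: U.basis_def)
  have liW: "W.lin_indpt b"
    using li span_li_not_depend(2)[OF bU sU] span_li_not_depend(2)[OF _ sW, of b] bU UW by auto
  have "W.basis b"
    using U.dim_basis[OF b] b d bU UW liW
    by (intro W.dim_li_is_basis[OF fW]) auto
  hence "W.span b = W" by (auto simp: W.basis_def)
  thus ?thesis
    using gen span_li_not_depend(1)[OF bU sU] span_li_not_depend(1)[OF _ sW, of b] bU UW by auto
qed

text \<open>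
  If the image of \<open>B\<close> lies in the kernel of \<open>A\<close>, then rank-nullity makes exactness at the
  middle space a matter of counting ranks. This turns a rank condition into a statement about
  individual vectors.
\<close>

lemma rank_plus_rank_iff_exact:
  fixes A B :: "'a::field mat"
  assumes A: "A \<in> carrier_mat nr nc" and B: "B \<in> carrier_mat nc k"
    and sub: "vec_space.col_space nc B \<subseteq> mat_kernel A"
  shows "vec_space.rank nr A + vec_space.rank nc B = nc \<longleftrightarrow> vec_space.col_space nc B = mat_kernel A"
proof -
  interpret C: vec_space "TYPE('a)" nc .
  have cB: "set (cols B) \<subseteq> carrier_vec nc" using B cols_dim by blast
  let ?U = "C.span (set (cols B))"
  have rn: "vec_space.rank nr A + vectorspace.dim class_ring (C.vs (mat_kernel A)) = nc"
    using rank_plus_kernel_dim[OF A] A by (simp add: kernel_dim_def)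
  have rB: "vec_space.rank nc B = vectorspace.dim class_ring (C.vs ?U)"
    by (simp add: C.rank_def)
  have subU: "VectorSpace.subspace class_ring ?U C.V"
    using cB by (simp add: C.span_is_subspace)
  note eq = C.subspace_eq_of_dim_eq[OF subU subspace_mat_kernel[OF A] _ C.fin_dim_span_cols[OF B] kernel_fin_dim[OF A]]
  show ?thesis
    using eq sub rn rB by (auto simp: C.col_space_def)
qed

text \<open>
  The case of exactness in which the map into the middle space is the matrix without columns.
\<close>

lemma rank_eq_dim_col_iff:
  fixes A :: "'a::field mat"
  assumes A: "A \<in> carrier_mat nr nc"
  shows "vec_space.rank nr A = nc \<longleftrightarrow> (\<forall>v\<in>carrier_vec nc. A *\<^sub>v v = 0\<^sub>v nr \<longrightarrow> v = 0\<^sub>v nc)"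
proof -
  interpret C: vec_space "TYPE('a)" nc .
  let ?Z = "0\<^sub>m nc 0 :: 'a mat"
  have Z: "C.col_space ?Z = {0\<^sub>v nc}"
    unfolding C.col_space_eq[OF zero_carrier_mat]
    by (auto simp: zero_mat_mult_vec intro: exI[of _ "vNil"])
  have "C.rank ?Z = 0" by (rule C.rank_0I)
  moreover have "C.col_space ?Z \<subseteq> mat_kernel A" using A by (auto simp: Z mat_kernel)
  ultimately show ?thesis
    using rank_plus_rank_iff_exact[OF A, of ?Z 0] A unfolding Z by (auto simp: mat_kernel)
qed

text \<open>
  Let \<open>M\<close> be the block matrix. It has \<open>n + k\<close> columns, where \<open>k = dim (ker E)\<close>, so its rank
  is \<open>n\<close> exactly when \<open>dim (ker M) = k\<close>. The kernel of \<open>M\<close> always contains \<open>ker E \<times> {0}\<close>, the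
  image of the injective matrix \<open>S\<close> padded by zero rows, so equality of dimensions means that
  \<open>E u + A S w = 0\<close> and \<open>C S w = 0\<close> force \<open>w = 0\<close>. With \<open>x = S w\<close> and \<open>z = - u\<close> this is the
  condition on the right.
\<close>

lemma rank_nullspace_block_iff:
  fixes E A C S :: "real mat"
  assumes E: "E \<in> carrier_mat n n" and A: "A \<in> carrier_mat n n" and C: "C \<in> carrier_mat m n"
    and S: "nullspace_matrix E S"
  shows "vec_space.rank (n + m) (four_block_mat E (A * S) (0\<^sub>m m n) (C * S)) = n \<longleftrightarrow>
    (\<forall>x\<in>carrier_vec n. \<forall>z\<in>carrier_vec n.
       E *\<^sub>v x = 0\<^sub>v n \<longrightarrow> C *\<^sub>v x = 0\<^sub>v m \<longrightarrow> A *\<^sub>v x = E *\<^sub>v z \<longrightarrow> x = 0\<^sub>v n)"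
    (is "?rank \<longleftrightarrow> ?cond")
proof -
  define k where "k = dim_col S"
  let ?M = "four_block_mat E (A * S) (0\<^sub>m m n) (C * S)"
  let ?N = "S @\<^sub>r 0\<^sub>m k k"
  have Sc: "S \<in> carrier_mat n k" and rS: "vec_space.rank n S = k"
    and csS: "vec_space.col_space n S = mat_kernel E"
    using S E unfolding nullspace_matrix_def k_def by auto
  have M: "?M \<in> carrier_mat (n + m) (n + k)" using E C Sc by auto
  have N: "?N \<in> carrier_mat (n + k) k" using Sc by auto
  have inj: "\<And>w. w \<in> carrier_vec k \<Longrightarrow> S *\<^sub>v w = 0\<^sub>v n \<Longrightarrow> w = 0\<^sub>v k"
    using rS rank_eq_dim_col_iff[OF Sc] by auto
  have kerE: "x \<in> carrier_vec n \<and> E *\<^sub>v x = 0\<^sub>v n \<longleftrightarrow> (\<exists>w\<in>carrier_vec k. S *\<^sub>v w = x)" for x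
  proof -
    have "x \<in> mat_kernel E \<longleftrightarrow> x \<in> vec_space.col_space n S" by (simp add: csS)
    thus ?thesis unfolding vec_space.col_space_eq[OF Sc] mat_kernel[OF E] using Sc by auto
  qed
  have Nv: "?N *\<^sub>v w = S *\<^sub>v w @\<^sub>v 0\<^sub>v k" if "w \<in> carrier_vec k" for w
    using mat_mult_append[OF Sc zero_carrier_mat that, of k] that by (simp add: zero_mat_mult_vec)
  have Mv: "?M *\<^sub>v (u @\<^sub>v w) = (E *\<^sub>v u + A *\<^sub>v (S *\<^sub>v w)) @\<^sub>v (C *\<^sub>v (S *\<^sub>v w))"
    if u: "u \<in> carrier_vec n" and w: "w \<in> carrier_vec k" for u w
    by (subst four_block_mat_mult_vec[where ?nr1.0=n and ?nc1.0=n and ?nr2.0=m and ?nc2.0=k])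
      (use E A C Sc u w in auto)
  have z0: "0\<^sub>v (a + b) = 0\<^sub>v a @\<^sub>v (0\<^sub>v b :: real vec)" for a b by auto
  have kerM: "u @\<^sub>v w \<in> mat_kernel ?M \<longleftrightarrow>
      E *\<^sub>v u + A *\<^sub>v (S *\<^sub>v w) = 0\<^sub>v n \<and> C *\<^sub>v (S *\<^sub>v w) = 0\<^sub>v m"
    if u: "u \<in> carrier_vec n" and w: "w \<in> carrier_vec k" for u w
    unfolding mat_kernel[OF M] using u w E A Sc
    by (simp add: Mv[OF u w] z0[of n m] append_vec_eq[of _ n])
  have csN: "u @\<^sub>v w \<in> vec_space.col_space (n + k) ?N \<longleftrightarrow> E *\<^sub>v u = 0\<^sub>v n \<and> w = 0\<^sub>v k"
    if u: "u \<in> carrier_vec n" and w: "w \<in> carrier_vec k" for u w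
  proof -
    have "u @\<^sub>v w \<in> vec_space.col_space (n + k) ?N \<longleftrightarrow> (\<exists>v\<in>carrier_vec k. S *\<^sub>v v @\<^sub>v 0\<^sub>v k = u @\<^sub>v w)"
      unfolding vec_space.col_space_eq[OF N] using N Nv u w by (simp add: carrier_matD)
    also have "\<dots> \<longleftrightarrow> (\<exists>v\<in>carrier_vec k. S *\<^sub>v v = u \<and> 0\<^sub>v k = w)"
      using Sc u by (intro bex_cong refl append_vec_eq[of _ n]) auto
    also have "\<dots> \<longleftrightarrow> E *\<^sub>v u = 0\<^sub>v n \<and> w = 0\<^sub>v k" using kerE[of u] u by auto
    finally show ?thesis .
  qed
  have rN: "vec_space.rank (n + k) ?N = k"
    unfolding rank_eq_dim_col_iff[OF N]
    using Sc inj by (auto simp: Nv z0[of n k] append_vec_eq[of _ n])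
  have csN_c: "vec_space.col_space (n + k) ?N \<subseteq> carrier_vec (n + k)"
    unfolding vec_space.col_space_eq[OF N] using N by auto
  have kerM_c: "mat_kernel ?M \<subseteq> carrier_vec (n + k)" by (rule mat_kernel_carrier[OF M])
  have split: "P \<subseteq> Q \<longleftrightarrow> (\<forall>u\<in>carrier_vec n. \<forall>w\<in>carrier_vec k. u @\<^sub>v w \<in> P \<longrightarrow> u @\<^sub>v w \<in> Q)"
    if "P \<subseteq> carrier_vec (n + k)" for P Q :: "real vec set"
    using that all_vec_append[of n k "\<lambda>v. v \<in> P \<longrightarrow> v \<in> Q"] by blast
  have AS0: "A *\<^sub>v (S *\<^sub>v 0\<^sub>v k) = 0\<^sub>v n" "C *\<^sub>v (S *\<^sub>v 0\<^sub>v k) = 0\<^sub>v m"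
    by (simp_all add: mult_mat_zero_vec[OF Sc] mult_mat_zero_vec[OF A] mult_mat_zero_vec[OF C])
  have sub: "vec_space.col_space (n + k) ?N \<subseteq> mat_kernel ?M"
    unfolding split[OF csN_c] using AS0 E by (auto simp: csN kerM)
  have "?rank \<longleftrightarrow> vec_space.col_space (n + k) ?N = mat_kernel ?M"
    using rank_plus_rank_iff_exact[OF M N sub] rN by simp
  also have "\<dots> \<longleftrightarrow> mat_kernel ?M \<subseteq> vec_space.col_space (n + k) ?N" using sub by blast
  also have "\<dots> \<longleftrightarrow> ?cond"
    unfolding split[OF kerM_c]
  proof (intro iffI ballI impI)
    fix x z :: "real vec"
    assume H: "\<forall>u\<in>carrier_vec n. \<forall>w\<in>carrier_vec k. u @\<^sub>v w \<in> mat_kernel ?M \<longrightarrow>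
        u @\<^sub>v w \<in> vec_space.col_space (n + k) ?N"
      and x: "x \<in> carrier_vec n" and z: "z \<in> carrier_vec n" and Ex: "E *\<^sub>v x = 0\<^sub>v n"
      and Cx: "C *\<^sub>v x = 0\<^sub>v m" and Ax: "A *\<^sub>v x = E *\<^sub>v z"
    obtain w where w: "w \<in> carrier_vec k" and xw: "S *\<^sub>v w = x" using kerE x Ex by blast
    have "E *\<^sub>v (- z) = - (E *\<^sub>v z)" using E z by (intro eq_vecI) auto
    hence "E *\<^sub>v (- z) + A *\<^sub>v x = 0\<^sub>v n" using Ax E z by simp
    hence "(- z) @\<^sub>v w \<in> mat_kernel ?M" using kerM[of "- z" w] z w xw Cx by simp
    hence "w = 0\<^sub>v k" using H csN[of "- z" w] z w by auto
    thus "x = 0\<^sub>v n" using xw Sc by auto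
  next
    fix u w :: "real vec"
    assume H: ?cond and u: "u \<in> carrier_vec n" and w: "w \<in> carrier_vec k"
      and k: "u @\<^sub>v w \<in> mat_kernel ?M"
    let ?x = "S *\<^sub>v w"
    have x: "?x \<in> carrier_vec n" and Ex: "E *\<^sub>v ?x = 0\<^sub>v n" using kerE w Sc by auto
    have eq: "E *\<^sub>v u + A *\<^sub>v ?x = 0\<^sub>v n" and Cx: "C *\<^sub>v ?x = 0\<^sub>v m" using k kerM[OF u w] by auto
    have "E *\<^sub>v (- u) = - (E *\<^sub>v u)" using E u by (intro eq_vecI) auto
    also have "\<dots> = A *\<^sub>v ?x"
    proof (rule eq_vecI)
      fix i assume "i < dim_vec (A *\<^sub>v ?x)"
      hence "i < n" using A by simp
      moreover have "(E *\<^sub>v u + A *\<^sub>v ?x) $ i = 0\<^sub>v n $ i" by (simp add: eq)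
      ultimately show "(- (E *\<^sub>v u)) $ i = (A *\<^sub>v ?x) $ i" using E A by simp
    qed (use E A in auto)
    finally have "A *\<^sub>v ?x = E *\<^sub>v (- u)" by simp
    moreover have "- u \<in> carrier_vec n" using u by simp
    ultimately have x0: "?x = 0\<^sub>v n" using H x Ex Cx by blast
    hence "w = 0\<^sub>v k" using inj w by blast
    moreover have "E *\<^sub>v u = 0\<^sub>v n" using eq x0 mult_mat_zero_vec[OF A] E u by simp
    ultimately show "u @\<^sub>v w \<in> vec_space.col_space (n + k) ?N" using csN[OF u w] by simp
  qed
  finally show ?thesis .
qed

section \<open>Impulse-free pencils\<close>

text \<open>
  For regular pencils this says that the index is at most one
  (\<open>regular_and_index_le_1_iff_impulse_free\<close>): in the language of descriptor systems, there are
  no impulsive solutions. Equivalently, the infinite eigenvalue has no Jordan chain of length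
  two, since such a chain is a pair with \<open>E x = 0\<close>, \<open>x \<noteq> 0\<close> and \<open>E z = A x\<close>.
\<close>

definition impulse_free :: "nat \<Rightarrow> 'a::field mat \<Rightarrow> 'a mat \<Rightarrow> bool" where
  "impulse_free n E A \<longleftrightarrow> (\<forall>x\<in>carrier_vec n. \<forall>z\<in>carrier_vec n.
     E *\<^sub>v x = 0\<^sub>v n \<longrightarrow> A *\<^sub>v x = E *\<^sub>v z \<longrightarrow> x = 0\<^sub>v n)"

lemma impulse_freeD:
  "impulse_free n E A \<Longrightarrow> x \<in> carrier_vec n \<Longrightarrow> z \<in> carrier_vec n \<Longrightarrow>
    E *\<^sub>v x = 0\<^sub>v n \<Longrightarrow> A *\<^sub>v x = E *\<^sub>v z \<Longrightarrow> x = 0\<^sub>v n"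
  by (auto simp: impulse_free_def)

lemma impulse_free_equivalent:
  fixes E A X Y :: "'a::field mat"
  assumes E: "E \<in> carrier_mat n n" and A: "A \<in> carrier_mat n n"
    and X: "X \<in> carrier_mat n n" "invertible_mat X" and Y: "Y \<in> carrier_mat n n" "invertible_mat Y"
    and f: "impulse_free n E A"
  shows "impulse_free n (X * E * Y) (X * A * Y)"
  unfolding impulse_free_def
proof (intro ballI impI)
  fix x z :: "'a vec"
  assume x: "x \<in> carrier_vec n" and z: "z \<in> carrier_vec n"
    and Ex: "X * E * Y *\<^sub>v x = 0\<^sub>v n" and Ax: "X * A * Y *\<^sub>v x = X * E * Y *\<^sub>v z"
  obtain X' where X': "X' \<in> carrier_mat n n" "X' * X = 1\<^sub>m n" using invertible_mat_inverse[OF X] by metis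
  obtain Y' where Y': "Y' \<in> carrier_mat n n" "Y' * Y = 1\<^sub>m n" using invertible_mat_inverse[OF Y] by metis
  have cancel: "X' *\<^sub>v (X * M * Y *\<^sub>v v) = M *\<^sub>v (Y *\<^sub>v v)"
    if M: "M \<in> carrier_mat n n" and v: "v \<in> carrier_vec n" for M v
  proof -
    have "X' *\<^sub>v (X * M * Y *\<^sub>v v) = X' *\<^sub>v (X *\<^sub>v (M *\<^sub>v (Y *\<^sub>v v)))"
      using X M Y v by (simp add: assoc_mult_mat_vec[of _ n n _ n])
    also have "\<dots> = (X' * X) *\<^sub>v (M *\<^sub>v (Y *\<^sub>v v))"
      using X X'(1) M Y v by (intro assoc_mult_mat_vec[symmetric]) auto
    also have "\<dots> = M *\<^sub>v (Y *\<^sub>v v)" using X'(2) M Y v by simp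
    finally show ?thesis .
  qed
  have "E *\<^sub>v (Y *\<^sub>v x) = 0\<^sub>v n" using cancel[OF E x] mult_mat_zero_vec[OF X'(1)] by (simp add: Ex)
  moreover have "A *\<^sub>v (Y *\<^sub>v x) = E *\<^sub>v (Y *\<^sub>v z)" using cancel[OF A x] cancel[OF E z] by (simp add: Ax)
  ultimately have "Y *\<^sub>v x = 0\<^sub>v n" using impulse_freeD[OF f, of "Y *\<^sub>v x" "Y *\<^sub>v z"] Y(1) x z by simp
  hence "(Y' * Y) *\<^sub>v x = Y' *\<^sub>v 0\<^sub>v n" using Y(1) Y'(1) x by simp
  thus "x = 0\<^sub>v n" using Y'(2) x mult_mat_zero_vec[OF Y'(1)] by simp
qed

lemma impulse_free_equivalent_iff:
  fixes E A X Y :: "'a::field mat"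
  assumes E: "E \<in> carrier_mat n n" and A: "A \<in> carrier_mat n n"
    and X: "X \<in> carrier_mat n n" "invertible_mat X" and Y: "Y \<in> carrier_mat n n" "invertible_mat Y"
  shows "impulse_free n (X * E * Y) (X * A * Y) \<longleftrightarrow> impulse_free n E A"
proof
  assume f: "impulse_free n (X * E * Y) (X * A * Y)"
  obtain X' where X': "X' \<in> carrier_mat n n" "X * X' = 1\<^sub>m n" "X' * X = 1\<^sub>m n"
    by (rule invertible_mat_inverse[OF X])
  obtain Y' where Y': "Y' \<in> carrier_mat n n" "Y * Y' = 1\<^sub>m n" "Y' * Y = 1\<^sub>m n"
    by (rule invertible_mat_inverse[OF Y])
  have undo: "X' * (X * M * Y) * Y' = M" if M: "M \<in> carrier_mat n n" for M
  proof -
    have "X' * (X * M * Y) * Y' = (X' * X) * M * (Y * Y')"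
      using X(1) Y(1) X'(1) Y'(1) M by (simp add: assoc_mult_mat[of _ n n _ n _ n])
    thus ?thesis using X' Y' M by simp
  qed
  have "impulse_free n (X' * (X * E * Y) * Y') (X' * (X * A * Y) * Y')"
    by (rule impulse_free_equivalent[OF _ _ X'(1) _ Y'(1) _ f])
      (use E A X(1) Y(1) invertible_matI_inverse[OF X'(1) X(1) X'(3,2)]
        invertible_matI_inverse[OF Y'(1) Y(1) Y'(3,2)] in auto)
  thus "impulse_free n E A" by (simp only: undo[OF E] undo[OF A])
qed (rule impulse_free_equivalent[OF assms])

text \<open>
  Real and imaginary parts of a complex chain of a real pencil are real chains. This links the
  real data of the system with the Weierstrass form, which exists over the complex numbers.
\<close>

lemma impulse_free_cmat:
  assumes E: "E \<in> carrier_mat n n" and A: "A \<in> carrier_mat n n"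
  shows "impulse_free n (cmat E) (cmat A) \<longleftrightarrow> impulse_free n E A"
proof
  assume f: "impulse_free n (cmat E) (cmat A)"
  show "impulse_free n E A" unfolding impulse_free_def
  proof (intro ballI impI)
    fix x z :: "real vec"
    assume x: "x \<in> carrier_vec n" and z: "z \<in> carrier_vec n"
      and Ex: "E *\<^sub>v x = 0\<^sub>v n" and Ax: "A *\<^sub>v x = E *\<^sub>v z"
    let ?c = "map_vec complex_of_real"
    have "cmat E *\<^sub>v ?c x = ?c (E *\<^sub>v x)" by (rule of_real_hom.mult_mat_vec_hom[OF E x, symmetric])
    hence 1: "cmat E *\<^sub>v ?c x = 0\<^sub>v n" by (simp add: Ex of_real_hom.vec_hom_zero)
    have 2: "cmat A *\<^sub>v ?c x = cmat E *\<^sub>v ?c z"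
      using of_real_hom.mult_mat_vec_hom[OF A x] of_real_hom.mult_mat_vec_hom[OF E z] Ax by metis
    have "?c x = 0\<^sub>v n" by (rule impulse_freeD[OF f _ _ 1 2]) (use x z in auto)
    thus "x = 0\<^sub>v n" by simp
  qed
next
  assume f: "impulse_free n E A"
  have Re_mult: "map_vec Re (cmat M *\<^sub>v v) = M *\<^sub>v map_vec Re v"
    and Im_mult: "map_vec Im (cmat M *\<^sub>v v) = M *\<^sub>v map_vec Im v"
    if M: "M \<in> carrier_mat n n" and v: "v \<in> carrier_vec n" for M v
    using M v by (auto intro!: eq_vecI simp: scalar_prod_def)
  show "impulse_free n (cmat E) (cmat A)" unfolding impulse_free_def
  proof (intro ballI impI)
    fix x z :: "complex vec"
    assume x: "x \<in> carrier_vec n" and z: "z \<in> carrier_vec n"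
      and Ex: "cmat E *\<^sub>v x = 0\<^sub>v n" and Ax: "cmat A *\<^sub>v x = cmat E *\<^sub>v z"
    have zero: "map_vec Re (0\<^sub>v n) = 0\<^sub>v n" "map_vec Im (0\<^sub>v n) = 0\<^sub>v n" by (auto intro!: eq_vecI)
    have "map_vec Re x = 0\<^sub>v n"
      by (rule impulse_freeD[OF f, of _ "map_vec Re z"])
        (use x z Re_mult[OF E x] Re_mult[OF E z] Re_mult[OF A x] Ex Ax zero in auto)
    moreover have "map_vec Im x = 0\<^sub>v n"
      by (rule impulse_freeD[OF f, of _ "map_vec Im z"])
        (use x z Im_mult[OF E x] Im_mult[OF E z] Im_mult[OF A x] Ex Ax zero in auto)
    ultimately show "x = 0\<^sub>v n"
      using x by (auto intro!: eq_vecI complex_eqI simp: vec_eq_iff)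
  qed
qed

text \<open>
  If \<open>s E - A\<close> were singular for every \<open>s\<close>, it would be singular as a matrix over the polynomial
  ring and annihilate a nonzero polynomial vector \<open>v(s) = \<Sum>\<^sub>k c\<^sub>k s\<^sup>k\<close>. Comparing coefficients
  gives \<open>A c\<^sub>k = E c\<^sub>k\<^sub>-\<^sub>1\<close>, so that the leading coefficient \<open>c\<^sub>d\<close> satisfies \<open>E c\<^sub>d = 0\<close> and
  \<open>A c\<^sub>d = E c\<^sub>d\<^sub>-\<^sub>1\<close>, which impulse-freeness excludes.
\<close>

lemma impulse_free_pencil_det_nonzero:
  fixes E A :: "'a::field_char_0 mat"
  assumes E: "E \<in> carrier_mat n n" and A: "A \<in> carrier_mat n n" and f: "impulse_free n E A"
  shows "\<exists>s. det (s \<cdot>\<^sub>m E - A) \<noteq> 0"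
proof -
  define M where "M = mat n n (\<lambda>(i, j). [:- A $$ (i, j), E $$ (i, j):])"
  have M: "M \<in> carrier_mat n n" by (simp add: M_def)
  have eval: "map_mat (\<lambda>p. poly p s) M = s \<cdot>\<^sub>m E - A" for s
    using E A by (intro eq_matI) (auto simp: M_def)
  have "det M \<noteq> 0"
  proof
    assume "det M = 0"
    then obtain v where v: "v \<in> carrier_vec n" "v \<noteq> 0\<^sub>v n" "M *\<^sub>v v = 0\<^sub>v n"
      using det_0_iff_vec_prod_zero[OF M] by blast
    define c where "c k = vec n (\<lambda>i. coeff (v $ i) k)" for k
    have c: "c k \<in> carrier_vec n" for k by (simp add: c_def)
    \<comment> \<open>Since \<open>k - 1 = 0\<close> at \<open>k = 0\<close>, the term that belongs to the coefficient of
      \<open>s\<^sup>-\<^sup>1\<close> has to be cut off by hand.\<close>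
    have co: "coeff ((M *\<^sub>v v) $ i) k =
        (if k = 0 then 0 else (E *\<^sub>v c (k - 1)) $ i) - (A *\<^sub>v c k) $ i" if i: "i < n" for i k
    proof -
      have "(M *\<^sub>v v) $ i = (\<Sum>j\<in>{0..<n}. [:- A $$ (i, j), E $$ (i, j):] * v $ j)"
        using i v(1) M by (simp add: scalar_prod_def M_def)
      hence "coeff ((M *\<^sub>v v) $ i) k = (\<Sum>j\<in>{0..<n}. coeff ([:- A $$ (i, j), E $$ (i, j):] * v $ j) k)"
        by (simp only: coeff_sum)
      also have "\<dots> = (\<Sum>j\<in>{0..<n}. (if k = 0 then 0 else E $$ (i, j) * coeff (v $ j) (k - 1)) - A $$ (i, j) * coeff (v $ j) k)"
        by (intro sum.cong refl) (cases k; simp)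
      also have "\<dots> = (if k = 0 then 0 else (E *\<^sub>v c (k - 1)) $ i) - (A *\<^sub>v c k) $ i"
        using i E A by (simp add: scalar_prod_def c_def sum_subtractf)
      finally show ?thesis .
    qed
    have rel: "A *\<^sub>v c k = (if k = 0 then 0\<^sub>v n else E *\<^sub>v c (k - 1))" for k
    proof (rule eq_vecI)
      fix i assume "i < dim_vec (if k = 0 then 0\<^sub>v n else E *\<^sub>v c (k - 1))"
      hence i: "i < n" using E by (auto split: if_splits)
      thus "(A *\<^sub>v c k) $ i = (if k = 0 then 0\<^sub>v n else E *\<^sub>v c (k - 1)) $ i"
        using co[OF i, of k] v(3) by (auto split: if_splits)
    qed (use E A in auto)
    obtain i where i: "i < n" "v $ i \<noteq> 0" using v(1,2) by (auto simp: vec_eq_iff)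
    have fin: "finite {k. c k \<noteq> 0\<^sub>v n}"
    proof (rule finite_subset)
      show "{k. c k \<noteq> 0\<^sub>v n} \<subseteq> (\<Union>i<n. {..degree (v $ i)})"
        by (auto simp: c_def vec_eq_iff intro!: le_degree)
    qed auto
    have "c (degree (v $ i)) \<noteq> 0\<^sub>v n" using i by (auto simp: c_def vec_eq_iff)
    hence ne: "{k. c k \<noteq> 0\<^sub>v n} \<noteq> {}" by blast
    define d where "d = Max {k. c k \<noteq> 0\<^sub>v n}"
    have d: "c d \<noteq> 0\<^sub>v n" using Max_in[OF fin ne] by (simp add: d_def)
    have "c (Suc d) = 0\<^sub>v n" using Max_ge[OF fin, of "Suc d"] by (force simp: d_def[symmetric])
    hence Ed: "E *\<^sub>v c d = 0\<^sub>v n" using rel[of "Suc d"] mult_mat_zero_vec[OF A] by simp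
    have "A *\<^sub>v c d = E *\<^sub>v (if d = 0 then 0\<^sub>v n else c (d - 1))"
      using rel[of d] mult_mat_zero_vec[OF E] by simp
    moreover have "(if d = 0 then 0\<^sub>v n else c (d - 1)) \<in> carrier_vec n" using c by simp
    ultimately have "c d = 0\<^sub>v n" using impulse_freeD[OF f c _ Ed] by blast
    with d show False by simp
  qed
  then obtain s where "poly (det M) s \<noteq> 0" 
    using poly_all_0_iff_0 by blast
  have "det (map_mat (\<lambda>p. poly p s) M) \<noteq> 0"
    using \<open>poly (det M) s \<noteq> 0\<close> by (simp add: comm_ring_hom.hom_det[OF poly_hom.comm_ring_hom_axioms])
  thus ?thesis unfolding eval by blast
qed

section \<open>Fitting decomposition\<close>

text \<open>
  The entries of the \<open>k\<close>-th power vanish below the \<open>k\<close>-th superdiagonal.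
\<close>

lemma strictly_upper_triangular_pow:
  fixes A :: "'a::comm_semiring_1 mat"
  assumes A: "A \<in> carrier_mat q q" and ut: "\<And>i j. i < q \<Longrightarrow> j \<le> i \<Longrightarrow> A $$ (i, j) = 0"
  shows "A ^\<^sub>m q = 0\<^sub>m q q"
proof -
  have "(A ^\<^sub>m k) $$ (i, j) = 0" if "i < q" "j < q" "j < i + k" for i j k
    using that
  proof (induct k arbitrary: j)
    case (Suc k)
    have c: "A ^\<^sub>m k \<in> carrier_mat q q" using A by simp
    have "(A ^\<^sub>m Suc k) $$ (i, j) = (\<Sum>l\<in>{0..<q}. (A ^\<^sub>m k) $$ (i, l) * A $$ (l, j))"
      using Suc.prems A c by (simp add: scalar_prod_def)
    also have "\<dots> = 0"
    proof (rule sum.neutral, intro ballI)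
      fix l assume "l \<in> {0..<q}"
      thus "(A ^\<^sub>m k) $$ (i, l) * A $$ (l, j) = 0"
        using Suc.hyps[of l] ut[of l j] Suc.prems by (cases "l < i + k") auto
    qed
    finally show ?case .
  qed (use A in auto)
  thus ?thesis using A by (intro eq_matI) (auto simp del: index_mult_mat)
qed

text \<open>
  Solvability of a Sylvester equation with disjoint spectra, in the case of a nilpotent right
  coefficient. With \<open>B = A1\<^sup>-\<^sup>1\<close>, the substitution \<open>X = B A2 + X'\<close> leaves an equation of the same
  kind for \<open>X'\<close> with right-hand side \<open>B A2 A4\<close>, which needs one power of \<open>A4\<close> less to vanish.
\<close>

lemma sylvester_nilpotent:
  fixes A1 A2 A4 :: "'a::field mat"
  assumes A1: "A1 \<in> carrier_mat p p" and A4: "A4 \<in> carrier_mat q q"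
    and B: "B \<in> carrier_mat p p" "A1 * B = 1\<^sub>m p"
    and A2: "A2 \<in> carrier_mat p q" and nil: "A2 * A4 ^\<^sub>m r = 0\<^sub>m p q"
  shows "\<exists>X\<in>carrier_mat p q. A1 * X = A2 + X * A4"
  using A2 nil
proof (induct r arbitrary: A2)
  case 0
  hence "A2 = 0\<^sub>m p q" using A4 by simp
  thus ?case using A1 A4 by (intro bexI[of _ "0\<^sub>m p q"]) auto
next
  case (Suc r)
  note c = Suc.prems(1) A1 A4 B(1)
  have "B * A2 * A4 * A4 ^\<^sub>m r = B * (A2 * (A4 * A4 ^\<^sub>m r))"
    using c pow_carrier_mat[OF A4, of r]
    by (simp add: assoc_mult_mat[of _ p p _ q _ q] assoc_mult_mat[of _ p q _ q _ q])
  also have "\<dots> = 0\<^sub>m p q" using Suc.prems(2) B unfolding pow_mat_Suc_left[OF A4] by simp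
  finally obtain X where X: "X \<in> carrier_mat p q" and eq: "A1 * X = B * A2 * A4 + X * A4"
    using Suc.hyps[of "B * A2 * A4"] c by auto
  have BA2: "B * A2 \<in> carrier_mat p q" using c by simp
  have "A1 * (B * A2 + X) = A1 * (B * A2) + A1 * X" using mult_add_distrib_mat[OF A1 BA2 X] .
  also have "A1 * (B * A2) = A2"
    using assoc_mult_mat[OF A1 B(1) Suc.prems(1)] B(2) Suc.prems(1) by simp
  also have "A1 * X = (B * A2 + X) * A4" unfolding eq using add_mult_distrib_mat[OF BA2 X A4] by simp
  finally show ?case using BA2 X by (intro bexI[of _ "B * A2 + X"]) auto
qed

lemma similar_mat_decouple:
  fixes A1 A2 A4 :: "'a::field mat"
  assumes A1: "A1 \<in> carrier_mat p p" and A2: "A2 \<in> carrier_mat p q" and A4: "A4 \<in> carrier_mat q q"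
    and X: "X \<in> carrier_mat p q" and eq: "A1 * X = A2 + X * A4"
  shows "similar_mat (four_block_mat A1 A2 (0\<^sub>m q p) A4) (four_block_mat A1 (0\<^sub>m p q) (0\<^sub>m q p) A4)"
proof -
  let ?P = "four_block_mat (1\<^sub>m p) (- X) (0\<^sub>m q p) (1\<^sub>m q)"
  let ?Q = "four_block_mat (1\<^sub>m p) X (0\<^sub>m q p) (1\<^sub>m q)"
  let ?D = "four_block_mat A1 (0\<^sub>m p q) (0\<^sub>m q p) A4"
  have XX: "X + - X = 0\<^sub>m p q" "- X + X = 0\<^sub>m p q"
    "- 0\<^sub>m q q = (0\<^sub>m q q :: 'a mat)" using X by auto
  have PQ: "?P * ?Q = 1\<^sub>m (p + q)"
    using X XX by (subst mult_four_block_mat[where ?n1.0=p and ?n2.0=q]) auto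
  have QP: "?Q * ?P = 1\<^sub>m (p + q)"
    using X XX by (subst mult_four_block_mat[where ?n1.0=p and ?n2.0=q]) auto
  have XA4: "X * A4 \<in> carrier_mat p q" using X A4 by simp
  have PD: "?P * ?D = four_block_mat A1 (- X * A4) (0\<^sub>m q p) A4"
    using A1 A4 X by (subst mult_four_block_mat[where ?n1.0=p and ?n2.0=q]) auto
  have "A1 * X + - X * A4 = A2"
    unfolding eq using A2 XA4 X A4 by (intro eq_matI) auto
  hence "?P * ?D * ?Q = four_block_mat A1 A2 (0\<^sub>m q p) A4"
    unfolding PD using A1 A4 X
    by (subst mult_four_block_mat[where ?n1.0=p and ?n2.0=q]) auto
  thus ?thesis unfolding similar_mat_def using PQ QP A1 A2 A4 X
    by (intro exI[of _ ?P] exI[of _ ?Q] similar_mat_witI[where n = "p + q"]) auto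
qed

text \<open>
  A Schur form whose diagonal lists the nonzero eigenvalues first has an invertible and a nilpotent
  diagonal block. The Sylvester equation removes the coupling between them.
\<close>

lemma fitting_decomposition:
  fixes K :: "complex mat"
  assumes K: "K \<in> carrier_mat n n"
  obtains p q K1 K2 where "n = p + q" "K1 \<in> carrier_mat p p" "det K1 \<noteq> 0"
    "K2 \<in> carrier_mat q q" "K2 ^\<^sub>m q = 0\<^sub>m q q"
    "similar_mat K (four_block_mat K1 (0\<^sub>m p q) (0\<^sub>m q p) K2)"
proof -
  obtain es where es: "char_poly K = (\<Prod>a\<leftarrow>es. [:- a, 1:])" "length es = n"
    using char_poly_factorized[OF K] by blast
  \<comment> \<open>The Schur form lists the eigenvalues in any prescribed order.\<close>
  define es1 where "es1 = filter (\<lambda>a. a \<noteq> 0) es"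
  define es2 where "es2 = filter (\<lambda>a. a = 0) es"
  define p where "p = length es1"
  define q where "q = length es2"
  have n: "n = p + q" using es(2) sum_length_filter_compl[of "\<lambda>a. a \<noteq> 0" es]
    by (simp add: p_def q_def es1_def es2_def)
  have "(\<Prod>a\<leftarrow>es. [:- a, 1:]) = (\<Prod>a\<leftarrow>es1 @ es2. [:- a, 1:])"
  proof -
    have "prod_list (map f es) = prod_list (map f es1) * prod_list (map f es2)"
      for f :: "complex \<Rightarrow> complex poly"
      unfolding es1_def es2_def by (induct es) (auto simp: mult_ac)
    thus ?thesis by simp
  qed
  hence cp: "char_poly K = (\<Prod>a\<leftarrow>es1 @ es2. [:- a, 1:])" using es(1) by simp
  obtain T P Q where schur: "schur_decomposition K (es1 @ es2) = (T, P, Q)" 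
    by (cases "schur_decomposition K (es1 @ es2)") auto
  from schur_decomposition[OF K cp schur]
  have sim: "similar_mat_wit K T P Q" and ut: "upper_triangular T" and diag: "diag_mat T = es1 @ es2"
    by auto
  have T: "T \<in> carrier_mat n n" using similar_mat_witD2[OF K sim] by simp
  obtain A1 A2 A3 A4 where sb: "split_block T p p = (A1, A2, A3, A4)" by (cases "split_block T p p")
  note blocks = split_block[OF sb, of q q]
  have A1: "A1 \<in> carrier_mat p p" and A2: "A2 \<in> carrier_mat p q" and A3: "A3 \<in> carrier_mat q p"
    and A4: "A4 \<in> carrier_mat q q" and TB: "T = four_block_mat A1 A2 A3 A4"
    using blocks T n by auto
  have Tdiag: "T $$ (i, i) = (es1 @ es2) ! i" if "i < n" for i
    using arg_cong[OF diag, of "\<lambda>xs. xs ! i"] that T by (simp add: diag_mat_def)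
  have "A3 = 0\<^sub>m q p"
  proof (rule eq_matI)
    fix i j assume ij: "i < dim_row (0\<^sub>m q p :: complex mat)" "j < dim_col (0\<^sub>m q p :: complex mat)"
    have "A3 $$ (i, j) = T $$ (i + p, j)" unfolding TB using ij A1 A2 A3 A4 by simp
    also have "\<dots> = 0" using ut ij T n by (auto intro!: upper_triangularD)
    finally show "A3 $$ (i, j) = 0\<^sub>m q p $$ (i, j)" using ij by simp
  qed (use A3 in auto)
  note TB = TB[unfolded this]
  have A1_ent: "A1 $$ (i, j) = T $$ (i, j)" if "i < p" "j < p" for i j
    unfolding TB using that A1 A4 by simp
  have ut1: "upper_triangular A1"
  proof (rule upper_triangularI)
    fix i j assume "j < i" "i < dim_row A1"
    thus "A1 $$ (i, j) = 0" using A1_ent[of i j] upper_triangularD[OF ut, of j i] A1 T n by simp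
  qed
  have "prod_list (diag_mat A1) \<noteq> 0"
  proof -
    have "A1 $$ (i, i) \<noteq> 0" if "i < p" for i
    proof -
      have "A1 $$ (i, i) = es1 ! i" using A1_ent Tdiag[of i] that n by (simp add: nth_append p_def)
      moreover have "es1 ! i \<in> set es1" using that by (simp add: p_def)
      ultimately show ?thesis by (auto simp: es1_def)
    qed
    thus ?thesis using A1 by (auto simp: diag_mat_def prod_list_zero_iff)
  qed
  hence det1: "det A1 \<noteq> 0" using det_upper_triangular[OF ut1 A1] by simp
  have nil: "A4 ^\<^sub>m q = 0\<^sub>m q q"
  proof (rule strictly_upper_triangular_pow[OF A4])
    fix i j assume ij: "i < q" "j \<le> i"
    have "A4 $$ (i, j) = T $$ (i + p, j + p)" unfolding TB using ij A1 A4 by simp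
    also have "\<dots> = 0"
    proof (cases "j = i")
      case True
      have "T $$ (i + p, i + p) = es2 ! i" using Tdiag[of "i + p"] ij n by (simp add: nth_append p_def)
      moreover have "es2 ! i \<in> set es2" using ij by (simp add: q_def)
      ultimately show ?thesis using True by (auto simp: es2_def)
    next
      case False
      thus ?thesis using ij upper_triangularD[OF ut, of "j + p" "i + p"] T n by simp
    qed
    finally show "A4 $$ (i, j) = 0" .
  qed
  obtain B where B: "B \<in> carrier_mat p p" "A1 * B = 1\<^sub>m p" by (rule det_nonzero_inverse[OF A1 det1])
  have "A2 * A4 ^\<^sub>m q = 0\<^sub>m p q" using A2 by (simp add: nil)
  from sylvester_nilpotent[OF A1 A4 B A2 this]
  obtain X where X: "X \<in> carrier_mat p q" "A1 * X = A2 + X * A4" by blast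
  have "similar_mat K T" using sim by (auto simp: similar_mat_def)
  moreover have "similar_mat T (four_block_mat A1 (0\<^sub>m p q) (0\<^sub>m q p) A4)"
    unfolding TB by (rule similar_mat_decouple[OF A1 A2 A4 X])
  ultimately have "similar_mat K (four_block_mat A1 (0\<^sub>m p q) (0\<^sub>m q p) A4)" by (rule similar_mat_trans)
  thus ?thesis using that n A1 det1 A4 nil by blast
qed

text \<open>
  Invertibility of \<open>I - l K\<close> for nilpotent \<open>K\<close>, stated for its kernel.
\<close>

lemma nilpotent_no_fixed_vec:
  fixes K :: "'a::field mat"
  assumes K: "K \<in> carrier_mat q q" and nil: "K ^\<^sub>m i = 0\<^sub>m q q"
    and v: "v \<in> carrier_vec q" and fix_v: "l \<cdot>\<^sub>v (K *\<^sub>v v) = v"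
  shows "v = 0\<^sub>v q"
proof -
  have "v = l ^ k \<cdot>\<^sub>v (K ^\<^sub>m k *\<^sub>v v)" for k
  proof (induct k)
    case (Suc k)
    have c: "K ^\<^sub>m k \<in> carrier_mat q q" using K by simp
    have "K ^\<^sub>m k *\<^sub>v v = K ^\<^sub>m k *\<^sub>v (l \<cdot>\<^sub>v (K *\<^sub>v v))" by (simp add: fix_v)
    also have "\<dots> = l \<cdot>\<^sub>v (K ^\<^sub>m k *\<^sub>v (K *\<^sub>v v))" using c K v by (intro mult_mat_vec) auto
    also have "\<dots> = l \<cdot>\<^sub>v (K ^\<^sub>m Suc k *\<^sub>v v)" by (simp add: assoc_mult_mat_vec[OF c K v])
    finally show ?case using Suc by (simp add: smult_smult_assoc mult.commute)
  qed (use v K in simp)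
  moreover have "l ^ i \<cdot>\<^sub>v 0\<^sub>v q = 0\<^sub>v q" by (intro eq_vecI) auto
  ultimately show ?thesis by (metis nil zero_mat_mult_vec[OF v])
qed

section \<open>Weierstrass form and index\<close>

lemma weierstrass_formI:
  assumes E: "E \<in> carrier_mat n n" and A: "A \<in> carrier_mat n n" and n: "n = p + q"
    and X: "X \<in> carrier_mat n n" "invertible_mat X" and Y: "Y \<in> carrier_mat n n" "invertible_mat Y"
    and J: "J \<in> carrier_mat p p" and N: "N \<in> carrier_mat q q" "nilpotent_mat N"
    and XEY: "X * cmat E * Y = four_block_mat (1\<^sub>m p) (0\<^sub>m p q) (0\<^sub>m q p) N"
    and XAY: "X * cmat A * Y = four_block_mat J (0\<^sub>m p q) (0\<^sub>m q p) (1\<^sub>m q)"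
  shows "weierstrass_form E A X Y J N"
proof -
  have "X * (s \<cdot>\<^sub>m cmat E - cmat A) * Y =
      four_block_mat (s \<cdot>\<^sub>m 1\<^sub>m p - J) (0\<^sub>m p q) (0\<^sub>m q p) (s \<cdot>\<^sub>m N - 1\<^sub>m q)" for s
  proof -
    have "X * (s \<cdot>\<^sub>m cmat E - cmat A) * Y = s \<cdot>\<^sub>m (X * cmat E * Y) - X * cmat A * Y"
      using E A X Y by (intro sandwich_pencil) auto
    also have "\<dots> = four_block_mat (s \<cdot>\<^sub>m 1\<^sub>m p - J) (0\<^sub>m p q) (0\<^sub>m q p) (s \<cdot>\<^sub>m N - 1\<^sub>m q)"
      unfolding XEY XAY using J N by (intro eq_matI) auto
    finally show ?thesis .
  qed
  thus ?thesis unfolding weierstrass_form_def using assms by blast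
qed

text \<open>
  Let \<open>M = \<alpha> E - \<beta> A\<close> be invertible and put \<open>K = M\<^sup>-\<^sup>1 E\<close>. For \<open>\<beta> \<noteq> 0\<close> the matrix
  \<open>M\<^sup>-\<^sup>1 A = (\<alpha> K - I) / \<beta>\<close> is a polynomial in \<open>K\<close>, so a similarity that splits \<open>K\<close> into an
  invertible block \<open>K1\<close> and a nilpotent block \<open>K2\<close> splits the whole pencil. It then remains to
  multiply the first block by \<open>K1\<^sup>-\<^sup>1\<close> and the second one by the inverse of
  \<open>H = (\<alpha> K2 - I) / \<beta>\<close>, which exists and commutes with \<open>K2\<close>; so \<open>N = H\<^sup>-\<^sup>1 K2\<close> is nilpotent.
  For \<open>\<beta> = 0\<close> the matrix \<open>E\<close> itself is invertible and there is no infinite eigenvalue.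
\<close>

lemma weierstrass_form_exists:
  assumes E: "E \<in> carrier_mat n n" and A: "A \<in> carrier_mat n n" and reg: "regular_pencil E A"
  shows "\<exists>X Y J N. weierstrass_form E A X Y J N"
proof -
  let ?E = "cmat E" and ?A = "cmat A"
  note as = assoc_mult_mat[of _ n n _ n _ n]
  have cE: "?E \<in> carrier_mat n n" and cA: "?A \<in> carrier_mat n n" using E A by auto
  obtain \<alpha> \<beta> where det: "det (\<alpha> \<cdot>\<^sub>m ?E - \<beta> \<cdot>\<^sub>m ?A) \<noteq> 0" using reg by (auto simp: regular_pencil_def)
  define M where "M = \<alpha> \<cdot>\<^sub>m ?E - \<beta> \<cdot>\<^sub>m ?A"
  have M: "M \<in> carrier_mat n n" using cA by (simp add: M_def minus_carrier_mat)
  obtain M' where M': "M' \<in> carrier_mat n n" "M * M' = 1\<^sub>m n" "M' * M = 1\<^sub>m n"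
    using det_nonzero_inverse[OF M] det by (metis M_def)
  define K where "K = M' * ?E"
  have K: "K \<in> carrier_mat n n" using M' cE by (simp add: K_def)
  have key: "\<alpha> \<cdot>\<^sub>m K - \<beta> \<cdot>\<^sub>m (M' * ?A) = 1\<^sub>m n"
  proof -
    have "M' * M = \<alpha> \<cdot>\<^sub>m (M' * ?E) - \<beta> \<cdot>\<^sub>m (M' * ?A)" unfolding M_def
      using mult_minus_distrib_mat[OF M'(1), of "\<alpha> \<cdot>\<^sub>m ?E" n "\<beta> \<cdot>\<^sub>m ?A"] cE cA
        mult_smult_distrib[OF M'(1) cE] mult_smult_distrib[OF M'(1) cA] by simp
    thus ?thesis using M'(3) by (simp add: K_def)
  qed
  show ?thesis
  proof (cases "\<beta> = 0")
    case True
    have aK: "\<alpha> \<cdot>\<^sub>m K = 1\<^sub>m n"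
    proof (rule eq_matI)
      fix i j assume ij: "i < dim_row (1\<^sub>m n :: complex mat)" "j < dim_col (1\<^sub>m n :: complex mat)"
      have "(\<alpha> \<cdot>\<^sub>m K - \<beta> \<cdot>\<^sub>m (M' * ?A)) $$ (i, j) = 1\<^sub>m n $$ (i, j)" by (simp add: key)
      thus "(\<alpha> \<cdot>\<^sub>m K) $$ (i, j) = 1\<^sub>m n $$ (i, j)" using ij K M' cA True by simp
    qed (use K in auto)
    have a0: "n = 0 \<or> \<alpha> \<noteq> 0"
      using arg_cong[OF aK, of "\<lambda>M. M $$ (0,0)"] K by (cases "n = 0") auto
    define X where "X = \<alpha> \<cdot>\<^sub>m M'"
    have X: "X \<in> carrier_mat n n" using M' by (simp add: X_def)
    have XE: "X * ?E = 1\<^sub>m n"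
      using aK mult_smult_assoc_mat[OF M'(1) cE] by (simp add: X_def K_def)
    have EX: "?E * X = 1\<^sub>m n" by (rule mat_mult_left_right_inverse[OF X cE XE])
    have "weierstrass_form E A X (1\<^sub>m n) (X * ?A) (0\<^sub>m 0 0)"
    proof (rule weierstrass_formI[OF E A, of n 0])
      show "invertible_mat X" by (rule invertible_matI_inverse[OF X cE XE EX])
      show "invertible_mat (1\<^sub>m n :: complex mat)"
        by (rule invertible_matI_inverse[of _ n "1\<^sub>m n"]) auto
      show "nilpotent_mat (0\<^sub>m 0 0)" by (auto simp: nilpotent_mat_def intro!: exI[of _ 1])
      show "X * ?E * 1\<^sub>m n = four_block_mat (1\<^sub>m n) (0\<^sub>m n 0) (0\<^sub>m 0 n) (0\<^sub>m 0 0)"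
        unfolding XE by (intro eq_matI) auto
      show "X * ?A * 1\<^sub>m n = four_block_mat (X * ?A) (0\<^sub>m n 0) (0\<^sub>m 0 n) (1\<^sub>m 0)"
        using X cA by (intro eq_matI) (auto simp del: index_mult_mat(1))
    qed (use X cA in auto)
    thus ?thesis by blast
  next
    case False
    define l where "l = \<alpha> / \<beta>"
    define c where "c = 1 / \<beta>"
    have MA: "M' * ?A = l \<cdot>\<^sub>m K - c \<cdot>\<^sub>m 1\<^sub>m n"
    proof (rule eq_matI)
      fix i j assume "i < dim_row (l \<cdot>\<^sub>m K - c \<cdot>\<^sub>m 1\<^sub>m n)" "j < dim_col (l \<cdot>\<^sub>m K - c \<cdot>\<^sub>m 1\<^sub>m n)"
      hence ij: "i < n" "j < n" using K by auto
      have "(\<alpha> \<cdot>\<^sub>m K - \<beta> \<cdot>\<^sub>m (M' * ?A)) $$ (i, j) = 1\<^sub>m n $$ (i, j)" by (simp add: key)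
      hence "\<alpha> * K $$ (i, j) - \<beta> * (M' * ?A) $$ (i, j) = 1\<^sub>m n $$ (i, j)"
        using ij K M' cA by (simp del: index_mult_mat(1))
      hence "(M' * ?A) $$ (i, j) = l * K $$ (i, j) - c * 1\<^sub>m n $$ (i, j)"
        using False by (simp add: l_def c_def field_simps)
      thus "(M' * ?A) $$ (i, j) = (l \<cdot>\<^sub>m K - c \<cdot>\<^sub>m 1\<^sub>m n) $$ (i, j)"
        using ij K by (simp del: index_mult_mat(1))
    qed (use K M' cA in auto)
    have c0: "c \<noteq> 0" using False by (simp add: c_def)
    obtain p q K1 K2 where n: "n = p + q" and K1: "K1 \<in> carrier_mat p p" "det K1 \<noteq> 0"
      and K2: "K2 \<in> carrier_mat q q" "K2 ^\<^sub>m q = 0\<^sub>m q q"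
      and sim: "similar_mat K (four_block_mat K1 (0\<^sub>m p q) (0\<^sub>m q p) K2)"
      by (rule fitting_decomposition[OF K])
    let ?D = "four_block_mat K1 (0\<^sub>m p q) (0\<^sub>m q p) K2"
    obtain P Q where "similar_mat_wit K ?D P Q" using sim by (auto simp: similar_mat_def)
    note PQ = similar_mat_witD2[OF K this]
    have D: "?D \<in> carrier_mat n n" using PQ by simp
    have QKP: "Q * K * P = ?D"
    proof -
      have "Q * K * P = (Q * P) * ?D * (Q * P)" unfolding PQ(3) using PQ(5,6,7) by (simp add: as)
      thus ?thesis by (simp only: PQ(2) left_mult_one_mat[OF D] right_mult_one_mat[OF D])
    qed
    obtain K1' where K1': "K1' \<in> carrier_mat p p" "K1 * K1' = 1\<^sub>m p" "K1' * K1 = 1\<^sub>m p"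
      by (rule det_nonzero_inverse[OF K1])
    define H where "H = l \<cdot>\<^sub>m K2 - c \<cdot>\<^sub>m 1\<^sub>m q"
    have H: "H \<in> carrier_mat q q" by (simp add: H_def minus_carrier_mat)
    \<comment> \<open>A kernel vector \<open>v\<close> of \<open>H\<close> would be fixed by \<open>(l / c) K2\<close>.\<close>
    have "det H \<noteq> 0"
    proof
      assume "det H = 0"
      then obtain v where v: "v \<in> carrier_vec q" "v \<noteq> 0\<^sub>v q" "H *\<^sub>v v = 0\<^sub>v q"
        using det_0_iff_vec_prod_zero_field[OF H] by blast
      have "(l / c) \<cdot>\<^sub>v (K2 *\<^sub>v v) = v"
      proof (rule eq_vecI)
        fix i assume "i < dim_vec v"
        hence i: "i < q" using v by simp
        have "H *\<^sub>v v = l \<cdot>\<^sub>m K2 *\<^sub>v v - c \<cdot>\<^sub>m 1\<^sub>m q *\<^sub>v v"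
          unfolding H_def using K2 v by (intro minus_mult_distrib_mat_vec) auto
        hence "(H *\<^sub>v v) $ i = l * (K2 *\<^sub>v v) $ i - c * v $ i" using i K2 v by simp
        hence "l * (K2 *\<^sub>v v) $ i = c * v $ i" using v(3) i by simp
        thus "((l / c) \<cdot>\<^sub>v (K2 *\<^sub>v v)) $ i = v $ i" using i K2 v c0
          by (simp add: field_simps)
      qed (use K2 v in auto)
      from nilpotent_no_fixed_vec[OF K2 v(1) this] v(2) show False by simp
    qed
    then obtain W where W: "W \<in> carrier_mat q q" "H * W = 1\<^sub>m q" "W * H = 1\<^sub>m q"
      by (rule det_nonzero_inverse[OF H])
    note asq = assoc_mult_mat[of _ q q _ q _ q]
    have HK: "H * K2 = K2 * H"
    proof -
      have "H * K2 = l \<cdot>\<^sub>m (K2 * K2) - c \<cdot>\<^sub>m K2"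
        unfolding H_def using K2(1) mult_smult_assoc_mat[of K2 q q K2 q l] mult_smult_assoc_mat[of "1\<^sub>m q" q q K2 q c]
        by (subst minus_mult_distrib_mat[of _ q q _ _ q]) auto
      moreover have "K2 * H = l \<cdot>\<^sub>m (K2 * K2) - c \<cdot>\<^sub>m K2"
        unfolding H_def using K2(1) mult_smult_distrib[of K2 q q K2 q l] mult_smult_distrib[of K2 q q "1\<^sub>m q" q c]
        by (subst mult_minus_distrib_mat[of _ q q _ q]) auto
      ultimately show ?thesis by simp
    qed
    have WK: "W * K2 = K2 * W"
    proof -
      have "W * K2 = W * (K2 * H) * W" using W H K2(1) by (simp add: asq)
      also have "\<dots> = (W * H) * K2 * W" unfolding HK[symmetric] using W(1) H K2(1) by (simp add: asq)
      finally show ?thesis using W K2(1) by simp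
    qed
    define N where "N = W * K2"
    have N: "N \<in> carrier_mat q q" using W K2 by (simp add: N_def)
    have "N ^\<^sub>m q = W ^\<^sub>m q * K2 ^\<^sub>m q" unfolding N_def by (rule commuting_product_pow[OF W(1) K2(1) WK])
    also have "\<dots> = 0\<^sub>m q q" using W(1) by (simp add: K2(2))
    finally have nil: "nilpotent_mat N" using N by (auto simp: nilpotent_mat_def)
    define J where "J = K1' * (l \<cdot>\<^sub>m K1 - c \<cdot>\<^sub>m 1\<^sub>m p)"
    have J: "J \<in> carrier_mat p p" using K1' by (simp add: J_def minus_carrier_mat)
    let ?L = "four_block_mat K1' (0\<^sub>m p q) (0\<^sub>m q p) W"
    let ?L' = "four_block_mat K1 (0\<^sub>m p q) (0\<^sub>m q p) H"
    have L: "?L \<in> carrier_mat n n" "?L' \<in> carrier_mat n n" using K1 K1' W H by (auto simp: n)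
    have LL: "?L * ?L' = 1\<^sub>m n" "?L' * ?L = 1\<^sub>m n" unfolding n
      using K1 K1' W H by (subst mult_four_block_mat[where ?n1.0=p and ?n2.0=q]; auto)+
    \<comment> \<open>\<open>Q M\<^sup>-\<^sup>1\<close> splits the pencil into blocks, \<open>?L\<close> normalises the blocks.\<close>
    define X where "X = ?L * (Q * M')"
    have QM: "Q * M' \<in> carrier_mat n n" "M * P \<in> carrier_mat n n" using PQ M M' by auto
    have X: "X \<in> carrier_mat n n" using L QM by (simp add: X_def)
    have "(Q * M') * (M * P) = 1\<^sub>m n" "(M * P) * (Q * M') = 1\<^sub>m n"
      using mult_inverse_of_product[OF PQ(7,6,2,1) M'(1) M M'(3,2)]
        mult_inverse_of_product[OF M M'(1) M'(2,3) PQ(6,7,1,2)] by auto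
    with mult_inverse_of_product[OF L LL QM] mult_inverse_of_product[OF QM(2,1) _ _ L(2,1) LL(2,1)]
    have "invertible_mat X" unfolding X_def
      using L QM by (intro invertible_matI_inverse[of _ n "(M * P) * ?L'"]) auto
    have trans: "X * Z * P = ?L * (Q * (M' * Z) * P)" if "Z \<in> carrier_mat n n" for Z
      unfolding X_def using that L PQ M' by (simp add: as)
    have XEP: "X * ?E * P = four_block_mat (1\<^sub>m p) (0\<^sub>m p q) (0\<^sub>m q p) N"
      unfolding trans[OF cE] K_def[symmetric] QKP N_def
      using K1 K1' W K2 by (subst mult_four_block_mat[where ?n1.0=p and ?n2.0=q]) auto
    have "Q * (l \<cdot>\<^sub>m K - c \<cdot>\<^sub>m 1\<^sub>m n) * P = l \<cdot>\<^sub>m ?D - Q * (c \<cdot>\<^sub>m 1\<^sub>m n) * P"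
      using sandwich_pencil[OF K _ PQ(7,6), of "c \<cdot>\<^sub>m 1\<^sub>m n" l] by (simp add: QKP)
    also have "Q * (c \<cdot>\<^sub>m 1\<^sub>m n) * P = c \<cdot>\<^sub>m 1\<^sub>m n"
      using mult_smult_distrib[OF PQ(7), of "1\<^sub>m n" n c] mult_smult_assoc_mat[OF PQ(7,6), of c] PQ by simp
    also have "l \<cdot>\<^sub>m ?D - c \<cdot>\<^sub>m 1\<^sub>m n = four_block_mat (l \<cdot>\<^sub>m K1 - c \<cdot>\<^sub>m 1\<^sub>m p) (0\<^sub>m p q) (0\<^sub>m q p) H"
      unfolding n H_def using K1 K2 by (intro eq_matI) auto
    finally have XAP: "X * ?A * P = four_block_mat J (0\<^sub>m p q) (0\<^sub>m q p) (1\<^sub>m q)"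
      unfolding trans[OF cA] MA J_def
      using K1 K1' W H by (simp, subst mult_four_block_mat[where ?n1.0=p and ?n2.0=q]) auto
    have "invertible_mat P" by (rule invertible_matI_inverse[OF PQ(6,7,1,2)])
    from weierstrass_formI[OF E A n X \<open>invertible_mat X\<close> PQ(6) this J N nil XEP XAP]
    show ?thesis by blast
  qed
qed

text \<open>
  A vector \<open>N\<^sup>k\<^sup>+\<^sup>1 v\<close> that \<open>N\<close> annihilates is a kernel vector of the
  first matrix which the second one maps to the image of \<open>N\<^sup>k v\<close>. Impulse-freeness therefore turns
  \<open>N\<^sup>k\<^sup>+\<^sup>2 = 0\<close> into \<open>N\<^sup>k\<^sup>+\<^sup>1 = 0\<close>, and descending from any vanishing power reaches \<open>N = 0\<close>.
\<close>

lemma impulse_free_weierstrass_blocks: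
  fixes J N :: "'a::field mat"
  assumes J: "J \<in> carrier_mat p p" and N: "N \<in> carrier_mat q q" and nil: "N ^\<^sub>m i = 0\<^sub>m q q"
  shows "impulse_free (p + q) (four_block_mat (1\<^sub>m p) (0\<^sub>m p q) (0\<^sub>m q p) N)
           (four_block_mat J (0\<^sub>m p q) (0\<^sub>m q p) (1\<^sub>m q)) \<longleftrightarrow> N = 0\<^sub>m q q"
    (is "impulse_free _ ?E ?A \<longleftrightarrow> _")
proof -
  have Ev: "?E *\<^sub>v (u @\<^sub>v w) = u @\<^sub>v (N *\<^sub>v w)" if "u \<in> carrier_vec p" "w \<in> carrier_vec q" for u w
    by (subst four_block_mat_mult_vec[where ?nr1.0=p and ?nc1.0=p and ?nr2.0=q and ?nc2.0=q])
      (use that N in auto)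
  have Av: "?A *\<^sub>v (u @\<^sub>v w) = (J *\<^sub>v u) @\<^sub>v w" if "u \<in> carrier_vec p" "w \<in> carrier_vec q" for u w
    by (subst four_block_mat_mult_vec[where ?nr1.0=p and ?nc1.0=p and ?nr2.0=q and ?nc2.0=q])
      (use that J in auto)
  have z0: "0\<^sub>v (p + q) = 0\<^sub>v p @\<^sub>v (0\<^sub>v q :: 'a vec)" by auto
  show ?thesis
  proof
    assume f: "impulse_free (p + q) ?E ?A"
    have step: "N ^\<^sub>m Suc k = 0\<^sub>m q q" if "N ^\<^sub>m Suc (Suc k) = 0\<^sub>m q q" for k
    proof -
      have "N ^\<^sub>m Suc k *\<^sub>v v = 0\<^sub>v q" if v: "v \<in> carrier_vec q" for v
      proof -
        let ?w = "N ^\<^sub>m Suc k *\<^sub>v v" and ?w' = "N ^\<^sub>m k *\<^sub>v v"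
        have c: "N ^\<^sub>m k \<in> carrier_mat q q" "N ^\<^sub>m Suc k \<in> carrier_mat q q" 
          using N by (auto simp del: pow_mat.simps)
        have w: "?w \<in> carrier_vec q" "?w' \<in> carrier_vec q" using c v by (auto simp del: pow_mat.simps)
        have "N *\<^sub>v ?w = (N * N ^\<^sub>m Suc k) *\<^sub>v v" using assoc_mult_mat_vec[OF N c(2) v] by simp
        also have "\<dots> = 0\<^sub>v q"
          using \<open>N ^\<^sub>m Suc (Suc k) = 0\<^sub>m q q\<close> zero_mat_mult_vec[OF v] unfolding pow_mat_Suc_left[OF N, symmetric] by simp
        finally have 1: "?E *\<^sub>v (0\<^sub>v p @\<^sub>v ?w) = 0\<^sub>v (p + q)" using Ev[of "0\<^sub>v p" ?w] w z0 by simp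
        have "N *\<^sub>v ?w' = ?w" unfolding pow_mat_Suc_left[OF N] using assoc_mult_mat_vec[OF N c(1) v] by simp
        hence 2: "?A *\<^sub>v (0\<^sub>v p @\<^sub>v ?w) = ?E *\<^sub>v (0\<^sub>v p @\<^sub>v ?w')"
          using Ev[of "0\<^sub>v p" ?w'] Av[of "0\<^sub>v p" ?w] w mult_mat_zero_vec[OF J] by simp
        have "0\<^sub>v p @\<^sub>v ?w = 0\<^sub>v (p + q)"
          by (rule impulse_freeD[OF f _ _ 1 2]) (use w in auto)
        thus ?thesis unfolding z0 by (subst (asm) append_vec_eq[of _ p]) auto
      qed
      thus ?thesis using N by (subst mat_eq_zero_iff) (auto simp del: pow_mat.simps)
    qed
    have "N ^\<^sub>m Suc k = 0\<^sub>m q q \<Longrightarrow> N ^\<^sub>m Suc 0 = 0\<^sub>m q q" for k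
      by (induct k) (use step in blast)+
    moreover have "N ^\<^sub>m Suc i = 0\<^sub>m q q" using nil N by simp
    ultimately have "N ^\<^sub>m Suc 0 = 0\<^sub>m q q" by blast
    thus "N = 0\<^sub>m q q" using N by simp
  next
    assume N0: "N = 0\<^sub>m q q"
    have "\<forall>x\<in>carrier_vec (p + q). \<forall>z\<in>carrier_vec (p + q).
        ?E *\<^sub>v x = 0\<^sub>v (p + q) \<longrightarrow> ?A *\<^sub>v x = ?E *\<^sub>v z \<longrightarrow> x = 0\<^sub>v (p + q)"
      unfolding all_vec_append
    proof (intro ballI impI)
      fix u w u' w' :: "'a vec"
      assume c: "u \<in> carrier_vec p" "w \<in> carrier_vec q" "u' \<in> carrier_vec p" "w' \<in> carrier_vec q"
        and 1: "?E *\<^sub>v (u @\<^sub>v w) = 0\<^sub>v (p + q)" and 2: "?A *\<^sub>v (u @\<^sub>v w) = ?E *\<^sub>v (u' @\<^sub>v w')"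
      have "u @\<^sub>v (N *\<^sub>v w) = 0\<^sub>v p @\<^sub>v 0\<^sub>v q" using 1 c Ev z0 by simp
      hence "u = 0\<^sub>v p" using c by (subst (asm) append_vec_eq[of _ p]) auto
      moreover have "(J *\<^sub>v u) @\<^sub>v w = u' @\<^sub>v (N *\<^sub>v w')" using 2 c Ev Av by simp
      hence "w = N *\<^sub>v w'" using c J by (subst (asm) append_vec_eq[of _ p]) auto
      ultimately show "u @\<^sub>v w = 0\<^sub>v (p + q)" using N0 c z0 zero_mat_mult_vec[OF c(4), of q] by simp
    qed
    thus "impulse_free (p + q) ?E ?A" by (simp add: impulse_free_def)
  qed
qed

text \<open>
  The values of the pencil identity at \<open>s = 0\<close> and \<open>s = 1\<close> recover the transformed \<open>A\<close> and \<open>E\<close>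
  separately. Since the right-hand side does not mention \<open>N\<close>, all Weierstrass forms agree on
  whether \<open>N\<close> vanishes.
\<close>

lemma weierstrass_form_impulse_free_iff:
  assumes E: "E \<in> carrier_mat n n" and wf: "weierstrass_form E A X Y J N"
  shows "N = 0\<^sub>m (dim_row N) (dim_col N) \<longleftrightarrow> impulse_free n E A"
proof -
  obtain p q where n: "n = p + q" and A: "A \<in> carrier_mat n n"
    and X: "X \<in> carrier_mat n n" "invertible_mat X" and Y: "Y \<in> carrier_mat n n" "invertible_mat Y"
    and J: "J \<in> carrier_mat p p" and N: "N \<in> carrier_mat q q" and nil: "nilpotent_mat N"
    and eq: "\<And>s. X * (s \<cdot>\<^sub>m cmat E - cmat A) * Y =
             four_block_mat (s \<cdot>\<^sub>m 1\<^sub>m p - J) (0\<^sub>m p q) (0\<^sub>m q p) (s \<cdot>\<^sub>m N - 1\<^sub>m q)"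
    using wf E unfolding weierstrass_form_def by auto
  have cE: "cmat E \<in> carrier_mat n n" and cA: "cmat A \<in> carrier_mat n n" using E A by auto
  have expand: "X * (s \<cdot>\<^sub>m cmat E - cmat A) * Y = s \<cdot>\<^sub>m (X * cmat E * Y) - X * cmat A * Y" for s
    by (rule sandwich_pencil[OF cE cA X(1) Y(1)])
  have XAY: "X * cmat A * Y = four_block_mat J (0\<^sub>m p q) (0\<^sub>m q p) (1\<^sub>m q)"
  proof (rule eq_matI)
    fix i j assume "i < dim_row (four_block_mat J (0\<^sub>m p q) (0\<^sub>m q p) (1\<^sub>m q))"
      "j < dim_col (four_block_mat J (0\<^sub>m p q) (0\<^sub>m q p) (1\<^sub>m q))"
    hence ij: "i < p + q" "j < p + q" using J by auto
    have "(0 \<cdot>\<^sub>m (X * cmat E * Y) - X * cmat A * Y) $$ (i,j) =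
      four_block_mat (0 \<cdot>\<^sub>m 1\<^sub>m p - J) (0\<^sub>m p q) (0\<^sub>m q p) (0 \<cdot>\<^sub>m N - 1\<^sub>m q) $$ (i,j)"
      using eq[of 0] expand[of 0] by metis
    thus "(X * cmat A * Y) $$ (i,j) = four_block_mat J (0\<^sub>m p q) (0\<^sub>m q p) (1\<^sub>m q) $$ (i,j)"
      using ij J N X(1) Y(1) cE cA n 
      by (auto simp del: index_mult_mat(1) simp: carrier_matD split: if_splits)
  qed (use X Y J n in auto)
  have XEY: "X * cmat E * Y = four_block_mat (1\<^sub>m p) (0\<^sub>m p q) (0\<^sub>m q p) N"
  proof (rule eq_matI)
    fix i j assume "i < dim_row (four_block_mat (1\<^sub>m p) (0\<^sub>m p q) (0\<^sub>m q p) N)"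
      "j < dim_col (four_block_mat (1\<^sub>m p) (0\<^sub>m p q) (0\<^sub>m q p) N)"
    hence ij: "i < p + q" "j < p + q" using N by auto
    have "(1 \<cdot>\<^sub>m (X * cmat E * Y) - X * cmat A * Y) $$ (i,j) =
      four_block_mat (1 \<cdot>\<^sub>m 1\<^sub>m p - J) (0\<^sub>m p q) (0\<^sub>m q p) (1 \<cdot>\<^sub>m N - 1\<^sub>m q) $$ (i,j)"
      using eq[of 1] expand[of 1] by metis
    thus "(X * cmat E * Y) $$ (i,j) = four_block_mat (1\<^sub>m p) (0\<^sub>m p q) (0\<^sub>m q p) N $$ (i,j)"
      using ij J N X(1) Y(1) cE cA n unfolding XAY
      by (auto simp del: index_mult_mat(1) simp: carrier_matD split: if_splits)
  qed (use X Y N n in auto)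
  obtain i where "N ^\<^sub>m i = 0\<^sub>m q q" using nil N by (auto simp: nilpotent_mat_def)
  from impulse_free_weierstrass_blocks[OF J N this]
  have "N = 0\<^sub>m q q \<longleftrightarrow> impulse_free n (X * cmat E * Y) (X * cmat A * Y)" by (simp add: XEY XAY n)
  also have "\<dots> \<longleftrightarrow> impulse_free n E A"
    using impulse_free_equivalent_iff[OF cE cA X Y] impulse_free_cmat[OF E A] by simp
  finally show ?thesis using N by simp
qed

lemma nilpotency_degree_le_1_iff:
  assumes N: "N \<in> carrier_mat q q" and nil: "nilpotent_mat N"
  shows "nilpotency_degree N \<le> 1 \<longleftrightarrow> N = 0\<^sub>m q q"
proof
  let ?P = "\<lambda>i. N ^\<^sub>m i = 0\<^sub>m q q"
  have d: "nilpotency_degree N = (LEAST i. ?P i)" using N by (simp add: nilpotency_degree_def)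
  { assume "N = 0\<^sub>m q q"
    hence "?P 1" using N by simp
    thus "nilpotency_degree N \<le> 1" unfolding d by (rule Least_le) }
  assume le: "nilpotency_degree N \<le> 1"
  have "?P (nilpotency_degree N)" unfolding d
    by (rule LeastI_ex) (use nil N in \<open>auto simp: nilpotent_mat_def\<close>)
  hence "?P 0 \<or> ?P 1" using le by (cases "nilpotency_degree N") auto
  thus "N = 0\<^sub>m q q"
  proof
    assume "?P 0"
    hence one: "1\<^sub>m q = (0\<^sub>m q q :: complex mat)" using N by simp
    have "N = N * 1\<^sub>m q" using N by simp
    thus ?thesis using N by (simp add: one)
  qed (use N in simp)
qed

text \<open>
  The index is read off from a chosen Weierstrass form; regularity guarantees that there is one to
  choose, and every such form has \<open>N = 0\<close> exactly when the pencil is impulse-free.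
\<close>

theorem regular_and_index_le_1_iff_impulse_free:
  assumes E: "E \<in> carrier_mat n n" and A: "A \<in> carrier_mat n n"
  shows "regular_pencil E A \<and> pencil_index E A \<le> 1 \<longleftrightarrow> impulse_free n E A"
proof -
  have reg: "regular_pencil E A" if "impulse_free n E A"
  proof -
    have "impulse_free n (cmat E) (cmat A)" using that impulse_free_cmat[OF E A] by simp
    then obtain s where "det (s \<cdot>\<^sub>m cmat E - cmat A) \<noteq> 0"
      using impulse_free_pencil_det_nonzero[of "cmat E" n "cmat A"] E A by auto
    moreover have "cmat A = 1 \<cdot>\<^sub>m cmat A" by auto
    ultimately show ?thesis unfolding regular_pencil_def by metis
  qed
  have "pencil_index E A \<le> 1 \<longleftrightarrow> impulse_free n E A" if "regular_pencil E A"
  proof -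
    define N where "N = (SOME N. \<exists>X Y J. weierstrass_form E A X Y J N)"
    have "\<exists>X Y J. weierstrass_form E A X Y J N" unfolding N_def
      by (rule someI_ex) (use weierstrass_form_exists[OF E A that] in blast)
    then obtain X Y J where wf: "weierstrass_form E A X Y J N" by blast
    then obtain q where N: "N \<in> carrier_mat q q" "nilpotent_mat N"
      unfolding weierstrass_form_def by blast
    have "pencil_index E A \<le> 1 \<longleftrightarrow> N = 0\<^sub>m q q"
      unfolding pencil_index_def N_def[symmetric] by (rule nilpotency_degree_le_1_iff[OF N])
    thus ?thesis using weierstrass_form_impulse_free_iff[OF E wf] N by simp
  qed
  with reg show ?thesis by blast
qed

section \<open>Port-Hamiltonian systems under output feedback\<close>

text \<open>
  The condition \<open>Q\<^sup>T P = 0\<close> makes the part \<open>P\<close> of the input matrix invisible after multiplication by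
  \<open>Q\<close>. Consequently the output matrix of a port-Hamiltonian system is \<open>C = B\<^sup>T Q\<close>: inputs and
  outputs are collocated.
\<close>

lemma output_matrix_eq:
  fixes G P Q :: "real mat"
  assumes G: "G \<in> carrier_mat n m" and P: "P \<in> carrier_mat n m" and Q: "Q \<in> carrier_mat n n"
    and QP: "transpose_mat Q * P = 0\<^sub>m n m"
  shows "transpose_mat (G + P) * Q = transpose_mat G * Q"
    and "transpose_mat (G - P) * Q = transpose_mat G * Q"
proof -
  have PQ: "transpose_mat P * Q = 0\<^sub>m m n"
    using arg_cong[OF QP, of transpose_mat] transpose_mult[of "transpose_mat Q" n n P m] P Q by simp
  have GQ: "transpose_mat G * Q \<in> carrier_mat m n" using G Q by simp
  have "transpose_mat (G + P) * Q = transpose_mat G * Q + transpose_mat P * Q"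
    using G P Q by (simp add: transpose_add[of _ n m] add_mult_distrib_mat[of _ m n _ _ n])
  thus "transpose_mat (G + P) * Q = transpose_mat G * Q" unfolding PQ using GQ by simp
  have "transpose_mat (G - P) * Q = transpose_mat G * Q - transpose_mat P * Q"
    using G P Q by (simp add: transpose_minus[of _ n m] minus_mult_distrib_mat[of _ m n _ _ n])
  also have "\<dots> = transpose_mat G * Q" unfolding PQ
  proof -
    have "Z - 0\<^sub>m m n = Z" if "Z \<in> carrier_mat m n" for Z :: "real mat"
      using that by (intro eq_matI) auto
    with GQ show "transpose_mat G * Q - 0\<^sub>m m n = transpose_mat G * Q" by blast
  qed
  finally show "transpose_mat (G - P) * Q = transpose_mat G * Q" .
qed

text \<open>
  The passivity data of a port-Hamiltonian system. The skew-symmetric part of \<open>J - R\<close> drops out of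
  the quadratic form \<open>(Q x)\<^sup>T A x\<close> and leaves \<open>- x\<^sup>T Q\<^sup>T R Q x\<close>.
\<close>

lemma port_hamiltonian_storage:
  assumes pH: "port_hamiltonian n m E A B C"
  obtains Q where "Q \<in> carrier_mat n n" "transpose_mat Q * E = transpose_mat E * Q"
    "C = transpose_mat B * Q"
    "\<And>x. x \<in> carrier_vec n \<Longrightarrow> (Q *\<^sub>v x) \<bullet> (A *\<^sub>v x) \<le> 0"
proof -
  obtain J R Q G P where c: "J \<in> carrier_mat n n" "R \<in> carrier_mat n n" "Q \<in> carrier_mat n n"
      "G \<in> carrier_mat n m" "P \<in> carrier_mat n m"
    and J: "J = - transpose_mat J" and AQ: "A = (J - R) * Q" and BG: "B = G - P"
    and CG: "C = transpose_mat (G + P) * Q" and QE: "transpose_mat Q * E = transpose_mat E * Q"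
    and psdR: "sym_pos_semidef n (transpose_mat Q * R * Q)"
    and QP: "transpose_mat Q * P = 0\<^sub>m n m"
    using pH unfolding port_hamiltonian_def by blast
  have CB: "C = transpose_mat B * Q"
    unfolding CG BG using output_matrix_eq[OF c(4,5,3) QP] by simp
  have "(Q *\<^sub>v x) \<bullet> (A *\<^sub>v x) \<le> 0" if x: "x \<in> carrier_vec n" for x
  proof -
    let ?v = "Q *\<^sub>v x"
    have v: "?v \<in> carrier_vec n" using c x by simp
    have "A *\<^sub>v x = (J - R) *\<^sub>v ?v" unfolding AQ using c x by (intro assoc_mult_mat_vec) auto
    also have "\<dots> = J *\<^sub>v ?v - R *\<^sub>v ?v" using c v by (intro minus_mult_distrib_mat_vec) auto
    finally have "?v \<bullet> (A *\<^sub>v x) = ?v \<bullet> (J *\<^sub>v ?v) - ?v \<bullet> (R *\<^sub>v ?v)"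
      using c v by (simp add: scalar_prod_minus_distrib[of _ n])
    moreover have "?v \<bullet> (J *\<^sub>v ?v) = 0" by (rule skew_quadratic_form_zero[OF c(1) J v])
    moreover have "?v \<bullet> (R *\<^sub>v ?v) = x \<bullet> (transpose_mat Q *\<^sub>v (R *\<^sub>v ?v))"
      using c v x by (intro scalar_prod_mult_mat_vec) auto
    moreover have "transpose_mat Q *\<^sub>v (R *\<^sub>v ?v) = (transpose_mat Q * R * Q) *\<^sub>v x"
      using c x v by (simp add: assoc_mult_mat_vec[of _ n n _ n])
    moreover have "0 \<le> x \<bullet> ((transpose_mat Q * R * Q) *\<^sub>v x)"
      using psdR x unfolding sym_pos_semidef_def by blast
    ultimately show ?thesis by simp
  qed
  with that c(3) QE CB show ?thesis by blast
qed

text \<open>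
  Negative output feedback acts as additional damping: \<open>A - B C = (J - R') Q\<close> with
  \<open>R' = R + B G\<^sup>T\<close>, and \<open>Q\<^sup>T R' Q = Q\<^sup>T R Q + C\<^sup>T C\<close> because \<open>Q\<^sup>T B = C\<^sup>T\<close>. All other
  matrices of the representation are kept.
\<close>

lemma port_hamiltonian_negative_feedback:
  assumes pH: "port_hamiltonian n m E A B C"
  shows "port_hamiltonian n m E (A - B * C) B C"
proof -
  have E: "E \<in> carrier_mat n n" and A: "A \<in> carrier_mat n n"
    and B: "B \<in> carrier_mat n m" and C: "C \<in> carrier_mat m n"
    using pH by (auto simp: port_hamiltonian_def)
  obtain J R Q G P where c: "J \<in> carrier_mat n n" "R \<in> carrier_mat n n" "Q \<in> carrier_mat n n"
      "G \<in> carrier_mat n m" "P \<in> carrier_mat n m"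
    and J: "J = - transpose_mat J" and AQ: "A = (J - R) * Q" and BG: "B = G - P"
    and CG: "C = transpose_mat (G + P) * Q" and QE: "transpose_mat Q * E = transpose_mat E * Q"
    and psdE: "sym_pos_semidef n (transpose_mat Q * E)"
    and psdR: "sym_pos_semidef n (transpose_mat Q * R * Q)"
    and QP: "transpose_mat Q * P = 0\<^sub>m n m"
    using pH unfolding port_hamiltonian_def by blast
  let ?QT = "transpose_mat Q" and ?GT = "transpose_mat G"
  have QT: "?QT \<in> carrier_mat n n" and GT: "?GT \<in> carrier_mat m n" using c by auto
  have CGQ: "C = ?GT * Q" unfolding CG by (rule output_matrix_eq(1)[OF c(4,5,3) QP])
  have CT: "transpose_mat C = ?QT * G" unfolding CGQ using transpose_mult[OF GT c(3)] by simp
  have QB: "?QT * B = transpose_mat C"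
    unfolding BG CT using mult_minus_distrib_mat[OF QT c(4,5)] QP QT c by auto
  let ?R = "R + B * ?GT"
  have BGT: "B * ?GT \<in> carrier_mat n n" using B GT by simp
  have R': "?R \<in> carrier_mat n n" using c(2) BGT by simp
  have "B * C = B * ?GT * Q" unfolding CGQ using assoc_mult_mat[OF B GT c(3)] by simp
  hence "A - B * C = (J - R - B * ?GT) * Q"
    unfolding AQ using minus_mult_distrib_mat[of "J - R" n n "B * ?GT" Q n] c BGT
    by (simp add: minus_carrier_mat)
  also have "J - R - B * ?GT = J - ?R"
  proof -
    have "J - R - Z = J - (R + Z)" if "Z \<in> carrier_mat n n" for Z
      using that c(1,2) by (intro eq_matI) auto
    thus ?thesis using BGT by blast
  qed
  finally have A': "A - B * C = (J - ?R) * Q" .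
  have "?QT * (B * ?GT) * Q = transpose_mat C * C"
  proof -
    have "?QT * (B * ?GT) * Q = (?QT * B) * (?GT * Q)"
      using QT B GT c(3) by (simp add: assoc_mult_mat[of _ n n _ n _ n] assoc_mult_mat[of _ n n _ m _ n]
          assoc_mult_mat[of _ n m _ n _ n])
    thus ?thesis by (simp only: QB CGQ[symmetric])
  qed
  moreover have "?QT * ?R * Q = ?QT * R * Q + ?QT * (B * ?GT) * Q"
    using mult_add_distrib_mat[OF QT c(2) BGT] add_mult_distrib_mat[of "?QT * R" n n "?QT * (B * ?GT)" Q n]
      QT c BGT by simp
  ultimately have W: "?QT * ?R * Q = ?QT * R * Q + transpose_mat C * C" by simp
  have QRQ: "?QT * R * Q \<in> carrier_mat n n" and CC: "transpose_mat C * C \<in> carrier_mat n n"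
    using c C by auto
  have sym: "transpose_mat (?QT * ?R * Q) = ?QT * ?R * Q"
    unfolding W using psdR transpose_add[OF QRQ CC] transpose_mult[of "transpose_mat C" n m C n] C
    by (simp add: sym_pos_semidef_def)
  have "transpose_mat (?QT * ?R * Q) = ?QT * transpose_mat ?R * Q"
  proof -
    have "transpose_mat (?QT * ?R * Q) = ?QT * transpose_mat (?QT * ?R)"
      using transpose_mult[of "?QT * ?R" n n Q n] QT R' c(3) by simp
    also have "transpose_mat (?QT * ?R) = transpose_mat ?R * Q"
      using transpose_mult[OF QT R'] by simp
    also have "?QT * (transpose_mat ?R * Q) = ?QT * transpose_mat ?R * Q"
      using QT R' c(3) by (intro assoc_mult_mat[symmetric]) auto
    finally show ?thesis .
  qed
  hence symR: "?QT * ?R * Q = ?QT * transpose_mat ?R * Q" using sym by simp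
  have psd: "sym_pos_semidef n (?QT * ?R * Q)"
    unfolding sym_pos_semidef_def
  proof (intro conjI ballI)
    show "transpose_mat (?QT * ?R * Q) = ?QT * ?R * Q" by (rule sym)
    show "?QT * ?R * Q \<in> carrier_mat n n" using QT R' c(3) by (intro mult_carrier_mat)
    fix v :: "real vec" assume v: "v \<in> carrier_vec n"
    have CT_c: "transpose_mat C \<in> carrier_mat n m" using C by simp
    have "v \<bullet> ((?QT * ?R * Q) *\<^sub>v v) = v \<bullet> ((?QT * R * Q) *\<^sub>v v) + v \<bullet> ((transpose_mat C * C) *\<^sub>v v)"
      unfolding W add_mult_distrib_mat_vec[OF QRQ CC v]
      using QRQ CC v by (intro scalar_prod_add_distrib) (auto simp del: assoc_mult_mat assoc_mult_mat_vec)
    also have "v \<bullet> ((transpose_mat C * C) *\<^sub>v v) = (C *\<^sub>v v) \<bullet> (C *\<^sub>v v)"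
      using scalar_prod_mult_mat_vec[OF C v, of "C *\<^sub>v v"] assoc_mult_mat_vec[OF CT_c C v] C v by simp
    finally show "0 \<le> v \<bullet> ((?QT * ?R * Q) *\<^sub>v v)"
      using psdR v scalar_prod_self_nonneg[of "C *\<^sub>v v"] by (auto simp: sym_pos_semidef_def)
  qed
  have "A - B * C \<in> carrier_mat n n" using A B C by (simp add: minus_carrier_mat)
  thus ?thesis unfolding port_hamiltonian_def
    using E B C c(1,3,4,5) R' J A' BG CG QE psdE symR psd QP by blast
qed

text \<open>
  Multiply \<open>(A - B C) x = E z\<close>, where \<open>E x = 0\<close>, from the left by \<open>(Q x)\<^sup>T\<close>. The right-hand side
  becomes \<open>x\<^sup>T E\<^sup>T Q z = 0\<close>, and the left-hand side is a nonpositive term minus \<open>\<parallel>C x\<parallel>\<^sup>2\<close>. So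
  \<open>C x = 0\<close>: the damping forces every chain of the closed loop at infinity to be an unobservable
  chain of the open loop.
\<close>

lemma port_hamiltonian_feedback_impulse_free:
  assumes pH: "port_hamiltonian n m E A B C"
    and cond: "\<And>x z. x \<in> carrier_vec n \<Longrightarrow> z \<in> carrier_vec n \<Longrightarrow> E *\<^sub>v x = 0\<^sub>v n \<Longrightarrow>
      C *\<^sub>v x = 0\<^sub>v m \<Longrightarrow> A *\<^sub>v x = E *\<^sub>v z \<Longrightarrow> x = 0\<^sub>v n"
  shows "impulse_free n E (A - B * C)"
  unfolding impulse_free_def
proof (intro ballI impI)
  fix x z :: "real vec"
  assume x: "x \<in> carrier_vec n" and z: "z \<in> carrier_vec n" and Ex: "E *\<^sub>v x = 0\<^sub>v n"
    and eq: "(A - B * C) *\<^sub>v x = E *\<^sub>v z"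
  have E: "E \<in> carrier_mat n n" and A: "A \<in> carrier_mat n n"
    and B: "B \<in> carrier_mat n m" and C: "C \<in> carrier_mat m n"
    using pH by (auto simp: port_hamiltonian_def)
  obtain Q where Q: "Q \<in> carrier_mat n n" and QE: "transpose_mat Q * E = transpose_mat E * Q"
    and CB: "C = transpose_mat B * Q" and diss: "(Q *\<^sub>v x) \<bullet> (A *\<^sub>v x) \<le> 0"
    using port_hamiltonian_storage[OF pH] x by metis
  let ?v = "Q *\<^sub>v x" and ?y = "C *\<^sub>v x"
  have v: "?v \<in> carrier_vec n" and y: "?y \<in> carrier_vec m" using Q C x by auto
  have ABC: "(A - B * C) *\<^sub>v x = A *\<^sub>v x - B *\<^sub>v ?y"
    using minus_mult_distrib_mat_vec[OF A _ x, of "B * C"] assoc_mult_mat_vec[OF B C x] B C by simp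
  have "?v \<bullet> (E *\<^sub>v z) = x \<bullet> (transpose_mat Q *\<^sub>v (E *\<^sub>v z))"
    using Q E x z by (intro scalar_prod_mult_mat_vec) auto
  also have "transpose_mat Q *\<^sub>v (E *\<^sub>v z) = (transpose_mat Q * E) *\<^sub>v z"
    using Q E z by (intro assoc_mult_mat_vec[symmetric]) auto
  also have "\<dots> = transpose_mat E *\<^sub>v (Q *\<^sub>v z)"
    unfolding QE using Q E z by (intro assoc_mult_mat_vec) auto
  also have "x \<bullet> \<dots> = (E *\<^sub>v x) \<bullet> (Q *\<^sub>v z)"
    using Q E x z by (intro scalar_prod_mult_mat_vec[symmetric]) auto
  also have "\<dots> = 0" unfolding Ex using Q z by simp
  finally have "?v \<bullet> (A *\<^sub>v x) - ?v \<bullet> (B *\<^sub>v ?y) = 0"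
    unfolding eq[symmetric] ABC using A B v x y by (simp add: scalar_prod_minus_distrib[of _ n])
  moreover have "?v \<bullet> (B *\<^sub>v ?y) = ?y \<bullet> ?y"
  proof -
    have "?v \<bullet> (B *\<^sub>v ?y) = (B *\<^sub>v ?y) \<bullet> ?v" using B y v by (intro comm_scalar_prod) auto
    also have "\<dots> = ?y \<bullet> (transpose_mat B *\<^sub>v ?v)" by (rule scalar_prod_mult_mat_vec[OF B y v])
    also have "transpose_mat B *\<^sub>v ?v = (transpose_mat B * Q) *\<^sub>v x"
      using B Q x by (intro assoc_mult_mat_vec[symmetric]) auto
    finally show ?thesis by (simp only: CB[symmetric])
  qed
  ultimately have "?y \<bullet> ?y = 0" using diss scalar_prod_self_nonneg[of ?y] by linarith
  hence Cx: "?y = 0\<^sub>v m" by (rule scalar_prod_self_eq_0[OF y])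
  have "A *\<^sub>v x = E *\<^sub>v z" using eq ABC Cx mult_mat_zero_vec[OF B] A x by simp
  with cond[OF x z Ex Cx] show "x = 0\<^sub>v n" .
qed

theorem theorem1:
  fixes n m :: nat and E A B C S :: "real mat"
  assumes "E \<in> carrier_mat n n" and "A \<in> carrier_mat n n"
    and "B \<in> carrier_mat n m" and "C \<in> carrier_mat m n"
    and "port_hamiltonian n m E A B C"
    and "nullspace_matrix E S"
  shows "(\<exists>F \<in> carrier_mat m m.
            regular_pencil E (A + B * F * C) \<and>
            pencil_index E (A + B * F * C) \<le> 1 \<and>
            port_hamiltonian n m E (A + B * F * C) B C)
         \<longleftrightarrow> vec_space.rank (n + m) (four_block_mat E (A * S) (0\<^sub>m m n) (C * S)) = n"
proof -
  note E = assms(1) and A = assms(2) and B = assms(3) and C = assms(4)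
  have closed: "A + B * F * C \<in> carrier_mat n n" if "F \<in> carrier_mat m m" for F
    using A B C that by simp
  show ?thesis
    unfolding rank_nullspace_block_iff[OF E A C assms(6)]
  proof (intro iffI ballI impI)
    fix x z :: "real vec"
    assume "\<exists>F \<in> carrier_mat m m. regular_pencil E (A + B * F * C) \<and>
        pencil_index E (A + B * F * C) \<le> 1 \<and> port_hamiltonian n m E (A + B * F * C) B C"
    then obtain F where F: "F \<in> carrier_mat m m"
      and "regular_pencil E (A + B * F * C)" "pencil_index E (A + B * F * C) \<le> 1" by blast
    hence f: "impulse_free n E (A + B * F * C)"
      using regular_and_index_le_1_iff_impulse_free[OF E closed[OF F]] by blast
    assume x: "x \<in> carrier_vec n" and z: "z \<in> carrier_vec n" and Ex: "E *\<^sub>v x = 0\<^sub>v n"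
      and Cx: "C *\<^sub>v x = 0\<^sub>v m" and Ax: "A *\<^sub>v x = E *\<^sub>v z"
    \<comment> \<open>On \<open>ker C\<close> every output feedback leaves \<open>A\<close> unchanged.\<close>
    have BF: "B * F \<in> carrier_mat n m" using B F by simp
    have "(A + B * F * C) *\<^sub>v x = A *\<^sub>v x + (B * F) *\<^sub>v (C *\<^sub>v x)"
      using add_mult_distrib_mat_vec[OF A mult_carrier_mat[OF BF C] x] assoc_mult_mat_vec[OF BF C x]
      by simp
    also have "\<dots> = E *\<^sub>v z" unfolding Cx mult_mat_zero_vec[OF BF] Ax using E z by simp
    finally show "x = 0\<^sub>v n" using impulse_freeD[OF f x z Ex] by blast
  next
    assume "\<forall>x\<in>carrier_vec n. \<forall>z\<in>carrier_vec n. E *\<^sub>v x = 0\<^sub>v n \<longrightarrow> C *\<^sub>v x = 0\<^sub>v m \<longrightarrow>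
        A *\<^sub>v x = E *\<^sub>v z \<longrightarrow> x = 0\<^sub>v n"
    \<comment> \<open>Unit negative feedback \<open>F = - I\<close> is a suitable choice.\<close>
    hence f: "impulse_free n E (A - B * C)"
      by (intro port_hamiltonian_feedback_impulse_free[OF assms(5)]) blast
    have "A + B * (- 1\<^sub>m m) * C = A - B * C"
      using A B C add_uminus_minus_mat[OF A mult_carrier_mat[OF B C]] by simp
    moreover have "A - B * C \<in> carrier_mat n n" using A B C by (simp add: minus_carrier_mat)
    ultimately show "\<exists>F \<in> carrier_mat m m. regular_pencil E (A + B * F * C) \<and>
        pencil_index E (A + B * F * C) \<le> 1 \<and> port_hamiltonian n m E (A + B * F * C) B C"
      using f regular_and_index_le_1_iff_impulse_free[OF E] port_hamiltonian_negative_feedback[OF assms(5)]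
      by (intro bexI[of _ "- 1\<^sub>m m"]) auto
  qed
qed

end
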